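(* Let $X_\infty$ be the doubled unit disk. For every closed geodesic $\gamma$ on $X_\infty$, the minimizing index $minind(\gamma)$ equals the number of line segments (chords) of which $\gamma$ is composed.
   Context: $X_\infty$ is the metric space obtained by gluing two copies (front and back) of the closed Euclidean unit disk along their common boundary circle, with the induced length metric $d$. A closed geodesic is a nonconstant, constant speed, locally length-minimizing closed curve $\gamma\colon S^1=[0,2\pi]/(0\sim 2\pi)\to \mathcal{M}$ in a metric space $\mathcal{M}$; let $L$ be its length. For an integer $k\ge 2$, $\gamma$ is a $1/k$ geodesic if $d(\gamma(t),\gamma(t+2\pi/k))=L/k$ for every $t\in S^1$. The minimizing index $minind(\gamma)$ is the smallest integer $k\ge 2$ such that $\gamma$ is a $1/k$ geodesic. Closed geodesics on $X_\infty$ are concatenations of chords of the disk between boundary points, lying alternately on the front and the back; the number of segments is the number of chords traversed in one full traversal of $\gamma$, counted with multiplicity (so a segment traversed several times, or once on each face, is counted each time). *)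

theory Defs
  imports "HOL-Analysis.Analysis"
begin

section \<open>Curves, closed geodesics and the minimizing index in a metric space\<close>

definition curve_length :: "(real \<Rightarrow> 'a::metric_space) \<Rightarrow> real \<Rightarrow> real \<Rightarrow> ereal" where
  "curve_length \<gamma> a b =
     (SUP (n, \<tau>) \<in> {(n::nat, \<tau>::nat \<Rightarrow> real). mono \<tau> \<and> \<tau> 0 = a \<and> \<tau> n = b}.
        ereal (\<Sum>i<n. dist (\<gamma> (\<tau> i)) (\<gamma> (\<tau> (Suc i)))))"

definition length_minimizing :: "(real \<Rightarrow> 'a::metric_space) \<Rightarrow> real \<Rightarrow> real \<Rightarrow> bool" where
  "length_minimizing \<gamma> a b \<longleftrightarrow>
     (\<forall>\<sigma>. continuous_on {a..b} \<sigma> \<and> \<sigma> a = \<gamma> a \<and> \<sigma> b = \<gamma> b \<longrightarrow>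
          curve_length \<gamma> a b \<le> curve_length \<sigma> a b)"

definition locally_length_minimizing :: "(real \<Rightarrow> 'a::metric_space) \<Rightarrow> bool" where
  "locally_length_minimizing \<gamma> \<longleftrightarrow>
     (\<forall>t. \<exists>e>0. \<forall>a b. t - e < a \<and> a \<le> b \<and> b < t + e \<longrightarrow> length_minimizing \<gamma> a b)"

definition constant_speed :: "(real \<Rightarrow> 'a::metric_space) \<Rightarrow> bool" where
  "constant_speed \<gamma> \<longleftrightarrow>
     (\<exists>c::real. \<forall>a b. a \<le> b \<longrightarrow> curve_length \<gamma> a b = ereal (c * (b - a)))"

text \<open>A curve on the circle \<open>[0, 2\<pi>] / (0 \<sim> 2\<pi>)\<close> is represented by its \<open>2\<pi>\<close>-periodic lift to the
  real line, so that parameter arithmetic on the circle becomes ordinary addition.\<close>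

definition closed_curve :: "(real \<Rightarrow> 'a::metric_space) \<Rightarrow> bool" where
  "closed_curve \<gamma> \<longleftrightarrow> continuous_on UNIV \<gamma> \<and> (\<forall>t. \<gamma> (t + 2 * pi) = \<gamma> t)"

definition closed_geodesic :: "(real \<Rightarrow> 'a::metric_space) \<Rightarrow> bool" where
  "closed_geodesic \<gamma> \<longleftrightarrow>
     closed_curve \<gamma> \<and> \<not> \<gamma> constant_on UNIV \<and> constant_speed \<gamma> \<and> locally_length_minimizing \<gamma>"

definition one_over_k :: "nat \<Rightarrow> (real \<Rightarrow> 'a::metric_space) \<Rightarrow> bool" where
  "one_over_k k \<gamma> \<longleftrightarrow>
     (\<forall>t. ereal (dist (\<gamma> t) (\<gamma> (t + 2 * pi / real k))) = curve_length \<gamma> 0 (2 * pi) / ereal (real k))"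

definition minind :: "(real \<Rightarrow> 'a::metric_space) \<Rightarrow> nat" where
  "minind \<gamma> = (LEAST k. 2 \<le> k \<and> one_over_k k \<gamma>)"


section \<open>The doubled disk\<close>

datatype face = Front | Back

definition glued :: "face \<times> complex \<Rightarrow> face \<times> complex \<Rightarrow> bool" where
  "glued x y \<longleftrightarrow>
     snd x \<in> cball 0 1 \<and> snd x = snd y \<and> (fst x = fst y \<or> snd x \<in> sphere 0 1)"

quotient_type doubled_disk = "face \<times> complex" / partial: glued
proof (rule part_equivpI)
  show "\<exists>x. glued x x"
    by (rule exI[of _ "(Front, 0)"]) (simp add: glued_def)
  show "symp glued"
    by (auto simp: glued_def symp_def)
  show "transp glued"
    by (auto simp: glued_def transp_def)
qed

definition on_face :: "face \<Rightarrow> complex \<Rightarrow> doubled_disk" where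
  "on_face f z = abs_doubled_disk (f, z)"

lift_definition disk_proj :: "doubled_disk \<Rightarrow> complex" is snd
  by (simp add: glued_def)

lemma disk_proj_on_face [simp]: "z \<in> cball 0 1 \<Longrightarrow> disk_proj (on_face f z) = z"
  unfolding on_face_def by (subst disk_proj.abs_eq) (auto simp: glued_def)

lemma on_face_eq_iff:
  assumes "z \<in> cball 0 1" "w \<in> cball 0 1"
  shows "on_face f z = on_face g w \<longleftrightarrow> z = w \<and> (f = g \<or> z \<in> sphere 0 1)"
  unfolding on_face_def
  using Quotient_rel[OF Quotient_doubled_disk, of "(f, z)" "(g, w)"] assms
  by (auto simp: glued_def)

lemma doubled_disk_cases:
  obtains f z where "p = on_face f z" "z \<in> cball 0 1"
proof -
  have "glued (rep_doubled_disk p) (rep_doubled_disk p)"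
    by (rule Quotient_rep_reflp[OF Quotient_doubled_disk])
  then show thesis
    using that[of "fst (rep_doubled_disk p)" "snd (rep_doubled_disk p)"]
      Quotient_abs_rep[OF Quotient_doubled_disk, of p]
    by (simp add: glued_def on_face_def)
qed

text \<open>A broken line of length \<open>l\<close> from \<open>p\<close> to \<open>q\<close>: finitely many Euclidean segments, each contained in
  one of the two disks, consecutive ones sharing an endpoint in the glued space.  The length metric
  of the gluing is the infimum of the lengths of broken lines; the lemma \<open>dist_eq_Inf_curve_length\<close>
  below confirms that it is intrinsic, i.e. equal to the infimum of the lengths of continuous curves.\<close>

inductive broken_line :: "doubled_disk \<Rightarrow> real \<Rightarrow> doubled_disk \<Rightarrow> bool" for p where
  nil: "broken_line p 0 p"
| seg: "broken_line p l (on_face f z) \<Longrightarrow> z \<in> cball 0 1 \<Longrightarrow> w \<in> cball 0 1 \<Longrightarrow>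
          broken_line p (l + dist z w) (on_face f w)"

lemma broken_line_single:
  "z \<in> cball 0 1 \<Longrightarrow> w \<in> cball 0 1 \<Longrightarrow> broken_line (on_face f z) (dist z w) (on_face f w)"
  using broken_line.seg[OF broken_line.nil] by fastforce

lemma broken_line_append:
  assumes "broken_line q m r" "broken_line p l q"
  shows "broken_line p (l + m) r"
  using assms
proof (induction rule: broken_line.induct)
  case nil
  then show ?case by simp
next
  case (seg m f z w)
  then have "broken_line p ((l + m) + dist z w) (on_face f w)"
    by (intro broken_line.seg)
  then show ?case by (simp add: add.assoc)
qed

lemma broken_line_rev: "broken_line p l q \<Longrightarrow> broken_line q l p"
proof (induction rule: broken_line.induct)
  case nil
  show ?case by (rule broken_line.nil)
next
  case (seg l f z w)
  then have "broken_line (on_face f w) (dist w z + l) p"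
    using broken_line_append[OF seg.IH broken_line_single[OF seg.hyps(3,2)]] by simp
  then show ?case by (simp add: dist_commute add.commute)
qed

lemma broken_line_exists: "\<exists>l. broken_line p l q"
proof -
  have *: "\<exists>l. broken_line p l (on_face Front 1)" for p
  proof -
    obtain f z where p: "p = on_face f z" "z \<in> cball 0 1" by (rule doubled_disk_cases)
    have "on_face f 1 = on_face Front 1" by (subst on_face_eq_iff) auto
    then show ?thesis using broken_line_single[of z 1 f] p by auto
  qed
  from *[of p] *[of q] show ?thesis
    using broken_line_append broken_line_rev by blast
qed

lemma broken_line_proj: "broken_line p l q \<Longrightarrow> dist (disk_proj p) (disk_proj q) \<le> l"
proof (induction rule: broken_line.induct)
  case (seg l f z w)
  then show ?case
    using dist_triangle[of "disk_proj p" w z] by (simp add: dist_commute)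
qed simp

lemma broken_line_nonneg: "broken_line p l q \<Longrightarrow> 0 \<le> l"
  using broken_line_proj[of p l q] zero_le_dist[of "disk_proj p" "disk_proj q"] by linarith

lemma broken_line_face:
  assumes "broken_line (on_face f z) l q" "z \<in> cball 0 1"
  shows "(\<exists>w\<in>cball 0 1. q = on_face f w) \<or> 1 - norm z \<le> l"
  using assms
proof (induction rule: broken_line.induct)
  case (seg l g z' w')
  from seg.IH[OF seg.prems] show ?case
  proof
    assume "\<exists>w\<in>cball 0 1. on_face g z' = on_face f w"
    then have "g = f \<or> norm z' = 1"
      using seg.hyps on_face_eq_iff by (auto simp: dist_norm)
    then show ?thesis
    proof
      assume "norm z' = 1"
      have "dist z z' \<le> l"
        using broken_line_proj[OF seg.hyps(1)] seg.hyps seg.prems by simp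
      then have "1 - norm z \<le> l"
        using \<open>norm z' = 1\<close> norm_triangle_sub[of z' z] by (simp add: dist_norm norm_minus_commute)
      then show ?thesis using zero_le_dist[of z' w'] by linarith
    qed (use seg.hyps in auto)
  next
    assume "1 - norm z \<le> l"
    then show ?thesis using zero_le_dist[of z' w'] by linarith
  qed
qed auto

instantiation doubled_disk :: metric_space
begin

definition dist_doubled_disk :: "doubled_disk \<Rightarrow> doubled_disk \<Rightarrow> real" where
  "dist_doubled_disk p q = Inf {l. broken_line p l q}"

definition uniformity_doubled_disk :: "(doubled_disk \<times> doubled_disk) filter" where
  "uniformity_doubled_disk = (INF e\<in>{0<..}. principal {(x, y). dist x y < e})"

definition open_doubled_disk :: "doubled_disk set \<Rightarrow> bool" where
  "open_doubled_disk U \<longleftrightarrow> (\<forall>x\<in>U. \<forall>\<^sub>F (x', y) in uniformity. x' = x \<longrightarrow> y \<in> U)"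

lemma broken_line_bdd: "bdd_below {l. broken_line p l q}"
  by (rule bdd_belowI[of _ 0]) (auto dest: broken_line_nonneg)

lemma dist_le_broken_line: "broken_line p l q \<Longrightarrow> dist p q \<le> l"
  unfolding dist_doubled_disk_def by (rule cInf_lower) (auto intro: broken_line_bdd)

lemma dist_greatest:
  assumes "\<And>l. broken_line p l q \<Longrightarrow> c \<le> l"
  shows "c \<le> dist p q"
  unfolding dist_doubled_disk_def
  by (rule cInf_greatest) (use broken_line_exists assms in auto)

instance
proof
  fix p q r :: doubled_disk
  show "dist p q = 0 \<longleftrightarrow> p = q"
  proof
    assume "p = q"
    then show "dist p q = 0"
      using dist_le_broken_line[OF broken_line.nil] dist_greatest[of p q 0] broken_line_nonneg
      by (auto intro: antisym)
  next
    assume 0: "dist p q = 0"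
    obtain f z where p: "p = on_face f z" "z \<in> cball 0 1" by (rule doubled_disk_cases)
    obtain g w where q: "q = on_face g w" "w \<in> cball 0 1" by (rule doubled_disk_cases)
    have "dist (disk_proj p) (disk_proj q) \<le> 0"
      using dist_greatest[OF broken_line_proj, of p q] 0 by simp
    then have zw: "z = w" using p q by simp
    show "p = q"
    proof (rule ccontr)
      assume "p \<noteq> q"
      then have ne: "f \<noteq> g" "norm z \<noteq> 1"
        using p q zw on_face_eq_iff[of z w f g] by auto
      have "1 - norm z \<le> l" if "broken_line p l q" for l
        using broken_line_face[of f z l q] that p q ne zw on_face_eq_iff by auto
      then have "1 - norm z \<le> dist p q" by (rule dist_greatest)
      then show False using 0 p ne by (auto simp: dist_norm)
    qed
  qed
  have "dist p q - dist r q \<le> dist p r"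
  proof (rule dist_greatest)
    fix l assume l: "broken_line p l r"
    have "dist p q - l \<le> dist r q"
    proof (rule dist_greatest)
      fix m assume "broken_line r m q"
      then have "dist p q \<le> l + m" using l by (intro dist_le_broken_line broken_line_append)
      then show "dist p q - l \<le> m" by simp
    qed
    then show "dist p q - dist r q \<le> l" by simp
  qed
  moreover have "dist r q = dist q r"
    unfolding dist_doubled_disk_def by (metis broken_line_rev)
  ultimately show "dist p q \<le> dist p r + dist q r" by simp
qed (simp_all add: uniformity_doubled_disk_def open_doubled_disk_def)

end

lemma dist_on_face:
  assumes "z \<in> cball 0 1" "w \<in> cball 0 1"
  shows "dist (on_face f z) (on_face f w) = dist z w"
proof (rule antisym)
  show "dist (on_face f z) (on_face f w) \<le> dist z w"
    by (rule dist_le_broken_line[OF broken_line_single[OF assms]])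
  show "dist z w \<le> dist (on_face f z) (on_face f w)"
    using broken_line_proj[of "on_face f z" _ "on_face f w"] assms by (intro dist_greatest) simp
qed

lemma broken_line_curve:
  "broken_line p l q \<Longrightarrow>
     \<exists>\<gamma>. \<gamma> 0 = p \<and> \<gamma> l = q \<and> (\<forall>s\<in>{0..l}. \<forall>t\<in>{s..l}. dist (\<gamma> s) (\<gamma> t) \<le> t - s)"
proof (induction rule: broken_line.induct)
  case nil
  show ?case by (rule exI[of _ "\<lambda>_. p"]) auto
next
  case (seg l f z w)
  then obtain \<gamma> where \<gamma>: "\<gamma> 0 = p" "\<gamma> l = on_face f z"
    "\<And>s t. 0 \<le> s \<Longrightarrow> s \<le> t \<Longrightarrow> t \<le> l \<Longrightarrow> dist (\<gamma> s) (\<gamma> t) \<le> t - s"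
    by auto
  have l0: "0 \<le> l" using broken_line_nonneg seg.hyps(1) .
  define d where "d = dist z w"
  show ?case
  proof (cases "d = 0")
    case True
    then show ?thesis using \<gamma> by (auto simp: d_def)
  next
    case False
    then have d: "0 < d" by (simp add: d_def)
    define \<delta> where "\<delta> t = linepath z w ((t - l) / d)" for t
    define \<sigma> where "\<sigma> t = (if t \<le> l then \<gamma> t else on_face f (\<delta> t))" for t
    have in_disk: "\<delta> t \<in> cball 0 1" if "t \<in> {l..l + d}" for t
    proof -
      have "(t - l) / d \<in> {0..1}" using that d by (auto simp: field_simps)
      then have "\<delta> t \<in> closed_segment z w"
        unfolding \<delta>_def by (rule linepath_in_path)
      then show ?thesis
        using closed_segment_subset[OF seg.hyps(2,3) convex_cball] by blast
    qed
    have \<delta>: "dist (on_face f (\<delta> s)) (on_face f (\<delta> t)) \<le> t - s" if "l \<le> s" "s \<le> t" "t \<le> l + d" for s t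
    proof -
      have "\<delta> s - \<delta> t = ((t - s) / d) *\<^sub>R (z - w)"
        unfolding \<delta>_def linepath_def using d
        by (simp add: diff_divide_distrib algebra_simps scaleR_conv_of_real)
      then have "dist (\<delta> s) (\<delta> t) = t - s"
        using d that by (simp add: dist_norm d_def)
      then show ?thesis using dist_on_face in_disk that by simp
    qed
    have \<delta>l: "on_face f (\<delta> l) = \<gamma> l" by (simp add: \<delta>_def linepath_def \<gamma>)
    show ?thesis
    proof (intro exI[of _ \<sigma>] conjI ballI)
      show "\<sigma> 0 = p" using l0 \<gamma> by (simp add: \<sigma>_def)
      show "\<sigma> (l + dist z w) = on_face f w"
        using d by (simp add: \<sigma>_def \<delta>_def linepath_def d_def[symmetric])
      fix s t assume "s \<in> {0..l + dist z w}" "t \<in> {s..l + dist z w}"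
      then have st: "0 \<le> s" "s \<le> t" "t \<le> l + d" by (auto simp: d_def)
      consider "t \<le> l" | "s \<le> l" "l < t" | "l < s" by linarith
      then show "dist (\<sigma> s) (\<sigma> t) \<le> t - s"
      proof cases
        case 2
        then show ?thesis
          using dist_triangle[of "\<gamma> s" "on_face f (\<delta> t)" "\<gamma> l"] \<gamma>(3)[of s l] \<delta>[of l t] st \<delta>l
          by (auto simp: \<sigma>_def)
      qed (use st \<gamma>(3)[of s t] \<delta>[of s t] in \<open>auto simp: \<sigma>_def\<close>)
    qed
  qed
qed

lemma dist_le_curve_length:
  assumes "a \<le> b"
  shows "ereal (dist (\<gamma> a) (\<gamma> b)) \<le> curve_length \<gamma> a b"
proof -
  have "mono (\<lambda>i::nat. if i = 0 then a else b)"
    using assms by (auto simp: mono_def)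
  then show ?thesis
    unfolding curve_length_def
    by (intro SUP_upper2[of "(1, \<lambda>i. if i = 0 then a else b)"]) auto
qed

lemma curve_length_le_Lipschitz:
  assumes "\<And>s t. a \<le> s \<Longrightarrow> s \<le> t \<Longrightarrow> t \<le> b \<Longrightarrow> dist (\<gamma> s) (\<gamma> t) \<le> c * (t - s)"
  shows "curve_length \<gamma> a b \<le> ereal (c * (b - a))"
  unfolding curve_length_def
proof (rule SUP_least, clarsimp)
  fix n :: nat and \<tau> :: "nat \<Rightarrow> real"
  assume \<tau>: "mono \<tau>" "a = \<tau> 0" "b = \<tau> n"
  have "(\<Sum>i<n. dist (\<gamma> (\<tau> i)) (\<gamma> (\<tau> (Suc i)))) \<le> (\<Sum>i<n. c * (\<tau> (Suc i) - \<tau> i))"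
    using \<tau> by (intro sum_mono assms) (auto intro: monoD)
  also have "\<dots> = c * (\<tau> n - \<tau> 0)"
    by (simp only: sum_distrib_left[symmetric] sum_lessThan_telescope)
  finally show "(\<Sum>i<n. dist (\<gamma> (\<tau> i)) (\<gamma> (\<tau> (Suc i)))) \<le> c * (\<tau> n - \<tau> 0)" .
qed

lemma dist_eq_Inf_curve_length:
  fixes p q :: doubled_disk
  shows "ereal (dist p q) =
    (INF \<sigma>\<in>{\<sigma>. continuous_on {0..1} \<sigma> \<and> \<sigma> 0 = p \<and> \<sigma> 1 = q}. curve_length \<sigma> 0 1)"
    (is "_ = ?I")
proof (rule antisym)
  show "ereal (dist p q) \<le> ?I"
    by (rule INF_greatest) (use dist_le_curve_length[of 0 1] in auto)
  have le: "?I \<le> ereal l" if l: "broken_line p l q" for l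
  proof -
    obtain \<gamma> where \<gamma>: "\<gamma> 0 = p" "\<gamma> l = q"
      "\<And>s t. 0 \<le> s \<Longrightarrow> s \<le> t \<Longrightarrow> t \<le> l \<Longrightarrow> dist (\<gamma> s) (\<gamma> t) \<le> t - s"
      using broken_line_curve[OF l] by auto
    have l0: "0 \<le> l" using broken_line_nonneg l .
    have lip: "dist (\<gamma> (l * s)) (\<gamma> (l * t)) \<le> l * (t - s)" if "0 \<le> s" "s \<le> t" "t \<le> 1" for s t
      using \<gamma>(3)[of "l * s" "l * t"] that l0 mult_left_mono[of s t l] mult_left_mono[of t 1 l]
      by (simp add: algebra_simps)
    have "l-lipschitz_on {0..1} (\<lambda>t. \<gamma> (l * t))"
    proof (rule lipschitz_onI)
      fix s t :: real assume "s \<in> {0..1}" "t \<in> {0..1}"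
      then show "dist (\<gamma> (l * s)) (\<gamma> (l * t)) \<le> l * dist s t"
        using lip[of s t] lip[of t s]
        by (cases "s \<le> t") (auto simp: dist_real_def dist_commute)
    qed (rule l0)
    then have "continuous_on {0..1} (\<lambda>t. \<gamma> (l * t))"
      by (rule lipschitz_on_continuous_on)
    moreover have "curve_length (\<lambda>t. \<gamma> (l * t)) 0 1 \<le> ereal l"
      using curve_length_le_Lipschitz[of 0 1 "\<lambda>t. \<gamma> (l * t)" l] lip by simp
    ultimately show ?thesis
      by (intro INF_lower2[of "\<lambda>t. \<gamma> (l * t)"]) (auto simp: \<gamma>)
  qed
  show "?I \<le> ereal (dist p q)"
  proof (rule ereal_le_epsilon2)
    fix e :: real assume "0 < e"
    then have "Inf {l. broken_line p l q} < dist p q + e"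
      by (simp add: dist_doubled_disk_def)
    then obtain l where "broken_line p l q" "l < dist p q + e"
      using broken_line_exists[of p q] broken_line_bdd[of p q] by (subst (asm) cInf_less_iff) auto
    then show "?I \<le> ereal (dist p q) + ereal e"
      using le[of l] order_trans[of ?I "ereal l" "ereal (dist p q + e)"] by simp
  qed
qed


section \<open>The number of segments\<close>

text \<open>One full traversal of \<open>\<gamma>\<close>, started at a suitable parameter \<open>\<tau> 0\<close> at which \<open>\<gamma>\<close> is on the boundary
  circle, is the concatenation of \<open>n\<close> chords \<open>[b i, b (i+1)]\<close>, the \<open>i\<close>-th one on the face \<open>f i\<close>.\<close>

definition composed_of_segments :: "(real \<Rightarrow> doubled_disk) \<Rightarrow> nat \<Rightarrow> bool" where
  "composed_of_segments \<gamma> n \<longleftrightarrow>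
     (\<exists>(\<tau> :: nat \<Rightarrow> real) (b :: nat \<Rightarrow> complex) (f :: nat \<Rightarrow> face).
        \<tau> n = \<tau> 0 + 2 * pi \<and> f n = f 0 \<and> (\<forall>i\<le>n. b i \<in> sphere 0 1) \<and>
        (\<forall>i<n. \<tau> i < \<tau> (Suc i) \<and> b i \<noteq> b (Suc i) \<and> f i \<noteq> f (Suc i) \<and>
           (\<forall>t\<in>{\<tau> i..\<tau> (Suc i)}.
              \<gamma> t = on_face (f i) (linepath (b i) (b (Suc i)) ((t - \<tau> i) / (\<tau> (Suc i) - \<tau> i))))))"

definition num_segments :: "(real \<Rightarrow> doubled_disk) \<Rightarrow> nat" where
  "num_segments \<gamma> = (THE n. composed_of_segments \<gamma> n)"

end

theory Submission
  imports Defs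
begin

text \<open>A minimizing arc meets the boundary circle at most twice: between two boundary points, which
  lie on both faces, it has to be the Euclidean chord, whose interior is off the circle.  Hence the
  boundary times of a closed geodesic are isolated, and by strict convexity the geodesic changes
  face at each of them; the first variation of length gives the billiard reflection law.  So all
  chords subtend the same angle and take the same time, \<open>b (i + 1) / b i\<close> being constant, and \<open>n\<close>
  chords have total length \<open>L = n \<ell>\<close>.  Moving a point by one chord carries it to the same relative
  position on the next chord; the ellipse through the common endpoint having the two points as foci
  touches the circle from inside, so every crossing point gives a path of length at least \<open>\<ell>\<close> and
  \<open>\<gamma>\<close> is a \<open>1/n\<close> geodesic.  For \<open>k < n\<close> the arc of length \<open>L/k\<close> starting at a boundary point goes
  around a corner, and is strictly longer than the Euclidean distance of its endpoints.\<close>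

section \<open>Segments in Euclidean space: equality in the triangle inequality, strict
  convexity\<close>

text \<open>Equality is forced in the triangle inequality, so \<open>p - z\<close> and
  \<open>z - q\<close> are nonnegative multiples of one vector, with lengths \<open>\<alpha>\<close>
  and \<open>\<beta>\<close>.\<close>

lemma between_points_eq_linepath:
  fixes p q z :: "'a::euclidean_space"
  assumes "dist p z \<le> \<alpha>" "dist z q \<le> \<beta>" "dist p q = \<alpha> + \<beta>" "\<alpha> + \<beta> > 0"
  shows "z = linepath p q (\<alpha> / (\<alpha> + \<beta>))"
proof -
  have d: "dist p z = \<alpha>" "dist z q = \<beta>"
    using dist_triangle[of p q z] assms by auto
  then have "norm (p - z) *\<^sub>R (z - q) = norm (z - q) *\<^sub>R (p - z)"
    using dist_triangle_eq[of p q z] assms by simp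
  then have "\<alpha> *\<^sub>R (z - q) = \<beta> *\<^sub>R (p - z)" using d by (simp add: dist_norm)
  then have "(\<alpha> + \<beta>) *\<^sub>R z = \<beta> *\<^sub>R p + \<alpha> *\<^sub>R q" by (simp add: algebra_simps)
  then have "z = (1 / (\<alpha> + \<beta>)) *\<^sub>R (\<beta> *\<^sub>R p + \<alpha> *\<^sub>R q)"
    using assms(4) by (metis divide_self_if less_irrefl scaleR_one scaleR_scaleR times_divide_eq_left mult_1)
  moreover have "1 - \<alpha> / (\<alpha> + \<beta>) = \<beta> / (\<alpha> + \<beta>)" using assms(4) by (simp add: field_simps)
  ultimately show ?thesis unfolding linepath_def by (simp add: scaleR_add_right)
qed

lemma norm_linepath_less:
  fixes p q :: "'a::euclidean_space"
  assumes "norm p \<le> r" "norm q \<le> r" "p \<noteq> q" "0 < u" "u < 1"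
  shows "norm (linepath p q u) < r"
proof -
  have "linepath p q u \<in> open_segment p q"
    using assms by (auto simp: linepath_def in_segment)
  then show ?thesis
    using dist_decreases_open_segment[of "linepath p q u" p q 0] assms by (auto simp: dist_norm)
qed

lemma dist_linepath:
  fixes p q :: "'a::real_normed_vector"
  shows "dist (linepath p q s) (linepath p q t) = \<bar>t - s\<bar> * dist p q"
proof -
  have "linepath p q s - linepath p q t = (t - s) *\<^sub>R (p - q)"
    by (simp add: linepath_def algebra_simps)
  then show ?thesis by (simp add: dist_norm)
qed

lemma linepath_in_cball:
  assumes "p \<in> cball 0 1" "q \<in> cball 0 1" "u \<in> {0..1}"
  shows "linepath p q u \<in> cball 0 (1::real)"
  using linepath_in_path[OF assms(3)] closed_segment_subset[OF assms(1,2) convex_cball] by blast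

section \<open>Chords of the unit disk\<close>

text \<open>For \<open>s\<close> in \<open>[0, 1]\<close> the two points on the chords are foci of
  an ellipse through \<open>1\<close> with major axis \<open>dist 1 \<omega>\<close>; the circle
  does not enter its interior.\<close>

lemma two_chords_dist_at_1:
  fixes \<omega> c :: complex
  assumes "norm \<omega> = 1" "norm c = 1"
  shows "dist 1 \<omega> \<le> dist (linepath (cnj \<omega>) 1 s) c + dist c (linepath 1 \<omega> s)"
proof (rule ccontr)
  define m k p q where "m = Re \<omega>" "k = Im \<omega>" "p = Re c" "q = Im c"
  have mk: "m\<^sup>2 + k\<^sup>2 = 1" and pq: "p\<^sup>2 + q\<^sup>2 = 1"
    using assms by (auto simp: m_k_p_q_def cmod_def)
  define u where "u = dist (linepath (cnj \<omega>) 1 s) c"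
  define v where "v = dist c (linepath 1 \<omega> s)"
  define E where "E = (dist 1 \<omega>)\<^sup>2"
  define D where "D = 1 - 2 * s"
  have E: "E = 2 - 2 * m"
    using mk by (simp add: E_def dist_norm cmod_power2 m_k_p_q_def) algebra
  have u: "u\<^sup>2 = (s + (1 - s) * m - p)\<^sup>2 + ((1 - s) * k + q)\<^sup>2"
    by (simp add: u_def dist_norm cmod_power2 m_k_p_q_def linepath_def) algebra
  have v: "v\<^sup>2 = (1 - s + s * m - p)\<^sup>2 + (s * k - q)\<^sup>2"
    by (simp add: v_def dist_norm cmod_power2 m_k_p_q_def linepath_def) algebra
  have Q: "u\<^sup>2 - v\<^sup>2 = 2 * ((1 - m) * D * p + k * q)"
    unfolding u v D_def using mk pq by algebra
  \<comment> \<open>Twofold tangency of the ellipse and the circle makes this expression a perfect square.\<close>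
  have "E * (2 * (u\<^sup>2 + v\<^sup>2) - E) - (u\<^sup>2 - v\<^sup>2)\<^sup>2 = 4 * (k * (1 - p) + (1 - m) * D * q)\<^sup>2"
    unfolding Q unfolding u v E D_def using mk pq by algebra
  then have "0 \<le> E * (2 * (u\<^sup>2 + v\<^sup>2) - E) - (u\<^sup>2 - v\<^sup>2)\<^sup>2" by simp
  \<comment> \<open>Heron's product for side lengths \<open>u\<close>, \<open>v\<close> and
    \<open>sqrt E\<close>: if \<open>u + v < sqrt E\<close>, both factors on the right are
    positive.\<close>
  also have "\<dots> = - ((E - (u + v)\<^sup>2) * (E - (u - v)\<^sup>2))" by algebra
  finally have le: "(E - (u + v)\<^sup>2) * (E - (u - v)\<^sup>2) \<le> 0" by simp
  assume "\<not> ?thesis"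
  then have "u + v < dist 1 \<omega>" by (simp add: u_def v_def)
  moreover have nn: "0 \<le> u" "0 \<le> v" by (auto simp: u_def v_def)
  ultimately have "(u + v)\<^sup>2 < E" unfolding E_def by (intro power_strict_mono) auto
  moreover have "(u - v)\<^sup>2 \<le> (u + v)\<^sup>2"
    using nn by (simp add: power2_eq_square algebra_simps)
  ultimately show False using le mult_pos_pos[of "E - (u + v)\<^sup>2" "E - (u - v)\<^sup>2"] by linarith
qed

text \<open>First variation: \<open>X\<close> and \<open>Y\<close> lie at distance
  \<open>\<epsilon>\<close> from \<open>1\<close> towards \<open>P\<close> and \<open>R\<close>, so
  the total distance to \<open>cis \<psi>\<close> is least at \<open>\<psi> = 0\<close>. The
  vanishing derivative says that the two directions have opposite tangential components.\<close>

lemma reflection_law_at_1: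
  fixes P R :: complex
  assumes "norm P = 1" "norm R = 1" "P \<noteq> 1" "R \<noteq> 1" "\<epsilon> > 0"
    "\<And>\<psi>. 2 * \<epsilon> \<le> dist (1 + (\<epsilon> / dist P 1) *\<^sub>R (P - 1)) (cis \<psi>) +
      dist (1 + (\<epsilon> / dist R 1) *\<^sub>R (R - 1)) (cis \<psi>)"
  shows "R = cnj P"
proof -
  define X Y where "X = 1 + (\<epsilon> / dist P 1) *\<^sub>R (P - 1)" "Y = 1 + (\<epsilon> / dist R 1) *\<^sub>R (R - 1)"
  define h where "h \<psi> = sqrt ((Re X - cos \<psi>)\<^sup>2 + (Im X - sin \<psi>)\<^sup>2) + sqrt ((Re Y - cos \<psi>)\<^sup>2 + (Im Y - sin \<psi>)\<^sup>2)" for \<psi>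
  have h: "h \<psi> = dist X (cis \<psi>) + dist Y (cis \<psi>)" for \<psi>
    by (simp add: h_def dist_norm cmod_def)
  have X: "dist X 1 = \<epsilon>" "dist Y 1 = \<epsilon>"
    using assms by (auto simp: X_Y_def dist_norm)
  then have sX: "sqrt ((Re X - 1)\<^sup>2 + (Im X)\<^sup>2) = \<epsilon>" "sqrt ((Re Y - 1)\<^sup>2 + (Im Y)\<^sup>2) = \<epsilon>"
    by (auto simp: dist_norm cmod_def)
  have pos: "(Re X - 1)\<^sup>2 + (Im X)\<^sup>2 > 0" "(Re Y - 1)\<^sup>2 + (Im Y)\<^sup>2 > 0"
    using sX assms(5) real_sqrt_gt_0_iff by metis+
  have "(h has_real_derivative (- Im X / \<epsilon> - Im Y / \<epsilon>)) (at 0)"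
    unfolding h_def using pos
    by (auto intro!: derivative_eq_intros simp: sX divide_simps)
  moreover have "\<forall>y. \<bar>0 - y\<bar> < 1 \<longrightarrow> h 0 \<le> h y"
    using assms(6) X by (simp add: h X_Y_def[symmetric])
  ultimately have "- Im X / \<epsilon> - Im Y / \<epsilon> = 0"
    by (rule DERIV_local_min[OF _ zero_less_one])
  then have "Im X = - Im Y" using assms(5) by (simp add: field_simps)
  then have im: "Im P * dist R 1 = - Im R * dist P 1"
  proof -
    have "\<epsilon> * (Im P * dist R 1) = \<epsilon> * (- Im R * dist P 1)"
      using \<open>Im X = - Im Y\<close> assms(3-5) by (simp add: X_Y_def field_simps)
    then show ?thesis using assms(5) mult_left_cancel[of \<epsilon>] by blast
  qed
  have sq: "(dist P 1)\<^sup>2 = 2 - 2 * Re P" "(Im P)\<^sup>2 = 1 - (Re P)\<^sup>2" if "norm P = 1" for P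
  proof -
    have *: "(Re P)\<^sup>2 + (Im P)\<^sup>2 = 1" using that by (simp add: cmod_def)
    then show "(Im P)\<^sup>2 = 1 - (Re P)\<^sup>2" by simp
    show "(dist P 1)\<^sup>2 = 2 - 2 * Re P"
      using * by (simp add: dist_norm cmod_power2) algebra
  qed
  have "(Im P)\<^sup>2 * (dist R 1)\<^sup>2 = (Im R)\<^sup>2 * (dist P 1)\<^sup>2"
    using arg_cong[OF im, of "\<lambda>x. x\<^sup>2"] by (simp add: power_mult_distrib)
  \<comment> \<open>Squaring has lost a sign: the real parts are compared first, and
    \<open>im\<close> then settles the sign of the imaginary parts.\<close>
  then have "(1 - Re P) * (1 - Re R) * (Re P - Re R) = 0"
    unfolding sq[OF assms(1)] sq[OF assms(2)] by algebra
  moreover have "Re P \<noteq> 1" "Re R \<noteq> 1"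
    using sq(1)[OF assms(1)] sq(1)[OF assms(2)] assms(3,4) by auto
  ultimately have re: "Re P = Re R" by simp
  then have "dist P 1 = dist R 1"
    using sq(1)[OF assms(1)] sq(1)[OF assms(2)] by (metis power2_eq_iff_nonneg zero_le_dist)
  then have "(Im P + Im R) * dist R 1 = 0" using im by (simp add: algebra_simps)
  then have "Im P = - Im R" using assms(4) by simp
  then show ?thesis using re by (simp add: complex_eq_iff)
qed

text \<open>Multiplication by \<open>q\<close> is an isometry taking \<open>1\<close> to
  \<open>q\<close>, and \<open>p * r = q\<^sup>2\<close> says that \<open>p / q\<close> and
  \<open>r / q\<close> are conjugate, which is the normalized case.\<close>

lemma two_chords_dist:
  fixes p q r c :: complex
  assumes "norm p = 1" "norm q = 1" "norm r = 1" "p * r = q\<^sup>2" "norm c = 1"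
  shows "dist p q \<le> dist (linepath p q s) c + dist c (linepath q r s)"
proof -
  define \<omega> where "\<omega> = r / q"
  have q: "q \<noteq> 0" "r \<noteq> 0" using assms(2,3) by auto
  have \<omega>: "norm \<omega> = 1" using assms by (simp add: \<omega>_def norm_divide)
  then have "cnj \<omega> = 1 / \<omega>"
    using complex_norm_square[of \<omega>] q by (simp add: \<omega>_def field_simps)
  also have "\<dots> = p / q" using assms(4) q by (simp add: \<omega>_def field_simps power2_eq_square)
  finally have p: "p = q * cnj \<omega>" using q by simp
  have r: "r = q * \<omega>" using q by (simp add: \<omega>_def)
  have c: "c = q * (c / q)" using q by simp
  have scale: "dist (q * x) (q * y) = dist x y" for x y
    using assms(2) by (simp add: dist_norm right_diff_distrib[symmetric] norm_mult)
  have l: "linepath (q * x) (q * y) s = q * linepath x y s" for x y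
    by (simp add: linepath_def algebra_simps)
  have "dist p q = dist 1 \<omega>"
    using scale[of "cnj \<omega>" 1] complex_mod_cnj[of "1 - \<omega>"]
    by (simp add: p dist_norm norm_minus_commute)
  also have "\<dots> \<le> dist (linepath (cnj \<omega>) 1 s) (c / q) + dist (c / q) (linepath 1 \<omega> s)"
    using assms by (intro two_chords_dist_at_1 \<omega>) (simp add: norm_divide)
  also have "\<dots> = dist (linepath (q * cnj \<omega>) (q * 1) s) (q * (c / q)) +
      dist (q * (c / q)) (linepath (q * 1) (q * \<omega>) s)"
    by (simp only: l scale)
  finally show ?thesis using p r c by simp
qed

text \<open>The hypothesis \<open>min\<close> compares the path through \<open>q\<close> with
  detours through other boundary points; \<open>p * r = q\<^sup>2\<close> expresses equal angles of
  incidence and reflection. A rotation reduces to \<open>q = 1\<close>.\<close>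

lemma reflection_law:
  fixes p q r :: complex
  assumes "norm p = 1" "norm q = 1" "norm r = 1" "p \<noteq> q" "r \<noteq> q" "\<epsilon> > 0"
    and min: "\<And>c. norm c = 1 \<Longrightarrow>
      2 * \<epsilon> \<le> dist (q + (\<epsilon> / dist p q) *\<^sub>R (p - q)) c + dist (q + (\<epsilon> / dist r q) *\<^sub>R (r - q)) c"
  shows "p * r = q\<^sup>2"
proof -
  have q: "q \<noteq> 0" using assms(2) by auto
  have scale: "dist (q * x) (q * y) = dist x y" for x y
    using assms(2) by (simp add: dist_norm right_diff_distrib[symmetric] norm_mult)
  have d: "dist (p / q) 1 = dist p q" for p
    using scale[of "p / q" 1] q by simp
  have e: "q * (1 + a *\<^sub>R (p / q - 1)) = q + a *\<^sub>R (p - q)" for a p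
    using q by (simp add: algebra_simps)
  have "r / q = cnj (p / q)"
  proof (rule reflection_law_at_1)
    fix \<psi>
    show "2 * \<epsilon> \<le> dist (1 + (\<epsilon> / dist (p / q) 1) *\<^sub>R (p / q - 1)) (cis \<psi>)
        + dist (1 + (\<epsilon> / dist (r / q) 1) *\<^sub>R (r / q - 1)) (cis \<psi>)"
      using min[of "q * cis \<psi>"] assms(2) unfolding d e[symmetric] scale by (simp add: norm_mult)
  qed (use assms q in \<open>auto simp: norm_divide\<close>)
  then have "(p / q) * (r / q) = 1"
    using complex_norm_square[of "p / q"] assms by (simp add: norm_divide)
  then show ?thesis using q by (simp add: field_simps power2_eq_square)
qed

section \<open>Distances in the doubled disk\<close>

lemma dist_disk_proj_le: "dist (disk_proj p) (disk_proj q) \<le> dist p q"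
  by (rule dist_greatest) (rule broken_line_proj)

lemma norm_disk_proj_le: "norm (disk_proj p) \<le> 1"
  by (rule doubled_disk_cases[of p]) auto

lemma disk_proj_in_cball: "disk_proj p \<in> cball 0 1"
  by (simp add: norm_disk_proj_le)

lemma continuous_on_disk_proj: "continuous_on A disk_proj"
proof -
  have "1-lipschitz_on A disk_proj"
    by (rule lipschitz_onI) (auto simp: dist_disk_proj_le)
  then show ?thesis by (rule lipschitz_on_continuous_on)
qed

lemma obtain_face: obtains f where "p = on_face f (disk_proj p)"
  by (rule doubled_disk_cases[of p]) auto

lemma on_face_boundary: "norm z = 1 \<Longrightarrow> on_face f z = on_face g z"
  by (subst on_face_eq_iff) auto

text \<open>Induction from the final segment: if its end \<open>w\<close> is on the circle,
  \<open>w\<close> serves as \<open>c\<close>. Otherwise \<open>z\<close> is reached on face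
  \<open>g\<close>, the part up to \<open>z\<close> already has a crossing, and the triangle
  inequality absorbs the final segment.\<close>

lemma broken_line_crossing:
  assumes "broken_line (on_face f x) l q" "x \<in> cball 0 1"
    "q = on_face g y" "y \<in> cball 0 1" "f \<noteq> g"
  shows "\<exists>c. norm c = 1 \<and> dist x c + dist c y \<le> l"
  using assms
proof (induction arbitrary: g y rule: broken_line.induct)
  case nil
  then have "x = y" "norm y = 1" using on_face_eq_iff[of x y f g] by auto
  then show ?case by (intro exI[of _ y]) auto
next
  case (seg l h z w)
  then have w: "w = y" "h = g \<or> norm w = 1" using on_face_eq_iff[of w y h g] by auto
  show ?case
  proof (cases "norm w = 1")
    case True
    have "dist x w \<le> l + dist z w"
      using broken_line_proj[OF broken_line.seg[OF seg.hyps]] seg.hyps(3) seg.prems(1)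
      by (simp del: mem_cball)
    then show ?thesis using True w by (intro exI[of _ w]) auto
  next
    case False
    then obtain c where "norm c = 1" "dist x c + dist c z \<le> l"
      using seg.IH[of g z] seg.hyps seg.prems w by auto
    then show ?thesis using dist_triangle[of c w z] w by (intro exI[of _ c]) auto
  qed
qed

lemma dist_on_face_boundary:
  assumes "norm z = 1" "w \<in> cball 0 1"
  shows "dist (on_face f z) (on_face g w) = dist z w"
  using on_face_boundary[OF assms(1), of f g] dist_on_face[of z w g] assms by simp

text \<open>Together with \<open>dist_opposite_faces_le\<close> this identifies the distance between
  opposite faces as the infimum of \<open>dist x c + dist c y\<close> over boundary points
  \<open>c\<close>.\<close>

lemma dist_opposite_faces_ge:
  assumes "f \<noteq> g" "x \<in> cball 0 1" "y \<in> cball 0 1"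
    "\<And>c. norm c = 1 \<Longrightarrow> d \<le> dist x c + dist c y"
  shows "d \<le> dist (on_face f x) (on_face g y)"
proof (rule dist_greatest)
  fix l assume "broken_line (on_face f x) l (on_face g y)"
  then obtain c where "norm c = 1" "dist x c + dist c y \<le> l"
    using broken_line_crossing[of f x l] assms by blast
  then show "d \<le> l" using assms(4) by fastforce
qed

lemma dist_opposite_faces_le:
  assumes "x \<in> cball 0 1" "y \<in> cball 0 1" "norm c = 1"
  shows "dist (on_face f x) (on_face g y) \<le> dist x c + dist c y"
  using dist_triangle[of "on_face f x" "on_face g y" "on_face f c"] assms
    dist_on_face[of x c f] dist_on_face_boundary[of c y f g] by simp

text \<open>A path shorter than \<open>1 - norm z\<close> starting at \<open>z\<close> reaches
  neither the circle nor, therefore, the other face.\<close>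

lemma open_on_face_ball: "open (on_face f ` ball 0 1)"
  unfolding open_dist
proof (clarsimp simp: dist_norm)
  fix z :: complex assume z: "norm z < 1"
  show "\<exists>e>0. \<forall>y. dist y (on_face f z) < e \<longrightarrow> y \<in> on_face f ` ball 0 1"
  proof (intro exI[of _ "1 - norm z"] conjI allI impI)
    fix y assume y: "dist y (on_face f z) < 1 - norm z"
    obtain g where g: "y = on_face g (disk_proj y)" by (rule obtain_face)
    have "dist (disk_proj y) z < 1 - norm z"
      using dist_disk_proj_le[of y "on_face f z"] y z by auto
    then have n: "norm (disk_proj y) < 1"
      using norm_triangle_sub[of "disk_proj y" z] by (simp add: dist_norm)
    have "g = f"
    proof (rule ccontr)
      assume "g \<noteq> f"
      then have "1 - norm z \<le> dist (on_face f z) (on_face g (disk_proj y))"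
      proof (rule dist_opposite_faces_ge[OF not_sym])
        fix c :: complex assume "norm c = 1"
        then show "1 - norm z \<le> dist z c + dist c (disk_proj y)"
          using dist_triangle[of 0 c z] zero_le_dist[of c "disk_proj y"] unfolding dist_0_norm by linarith
      qed (use z norm_disk_proj_le in auto)
      then show False using y g by (simp add: dist_commute)
    qed
    then show "y \<in> on_face f ` ball 0 1" using g n by auto
  qed (use z in auto)
qed

text \<open>The two open faces are disjoint open sets, so the connected image of the interval lies
  in one of them.\<close>

lemma face_constant_on_interval:
  assumes "continuous_on {u<..<v} \<gamma>" "u < (v::real)"
    "\<And>t. u < t \<Longrightarrow> t < v \<Longrightarrow> norm (disk_proj (\<gamma> t)) < 1"
  shows "\<exists>f. \<forall>t. u < t \<longrightarrow> t < v \<longrightarrow> \<gamma> t = on_face f (disk_proj (\<gamma> t))"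
proof -
  let ?S = "\<gamma> ` {u<..<v}"
  have conn: "connected ?S"
    by (rule connected_continuous_image[OF assms(1)]) auto
  have cov: "p \<in> on_face Front ` ball 0 1 \<or> p \<in> on_face Back ` ball 0 1" if "p \<in> ?S" for p
  proof -
    obtain f where f: "p = on_face f (disk_proj p)" by (rule obtain_face)
    moreover have "norm (disk_proj p) < 1" using that assms(3) by auto
    ultimately have "p \<in> on_face f ` ball 0 1" by auto
    then show ?thesis by (cases f) auto
  qed
  have "on_face Front ` ball 0 1 \<inter> on_face Back ` ball 0 1 = {}"
    by (auto simp: on_face_eq_iff)
  then have "on_face Front ` ball 0 1 \<inter> ?S = {} \<or> on_face Back ` ball 0 1 \<inter> ?S = {}"
    using connectedD[OF conn open_on_face_ball open_on_face_ball, of Front Back] cov by blast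
  then obtain f where "?S \<subseteq> on_face f ` ball 0 1" using cov by blast
  then have "\<forall>t. u < t \<longrightarrow> t < v \<longrightarrow> \<gamma> t = on_face f (disk_proj (\<gamma> t))"
    by (force simp: image_subset_iff)
  then show ?thesis by blast
qed

section \<open>Geodesics\<close>

text \<open>Curve length is eliminated here: the later arguments use only a global Lipschitz bound
  and its sharpness on all subintervals of a neighbourhood of each time.\<close>

locale geodesic_line =
  fixes \<gamma> :: "real \<Rightarrow> doubled_disk" and c :: real
  assumes speed_pos: "c > 0"
    and dist_le: "a \<le> b \<Longrightarrow> dist (\<gamma> a) (\<gamma> b) \<le> c * (b - a)"
    and local_isometry: "\<exists>e>0. \<forall>a b. t - e < a \<longrightarrow> a \<le> b \<longrightarrow> b < t + e \<longrightarrow>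
          dist (\<gamma> a) (\<gamma> b) = c * (b - a)"

text \<open>Each broken line between the endpoints, reparametrized over \<open>[a, b]\<close>, is a
  competitor of length at most \<open>l\<close>; the distance is the infimum of these
  \<open>l\<close>.\<close>

lemma length_minimizing_le_dist:
  fixes \<gamma> :: "real \<Rightarrow> doubled_disk"
  assumes "length_minimizing \<gamma> a b" "a < b" "curve_length \<gamma> a b = ereal m"
  shows "m \<le> dist (\<gamma> a) (\<gamma> b)"
proof (rule dist_greatest)
  fix l assume l: "broken_line (\<gamma> a) l (\<gamma> b)"
  then obtain \<sigma> where \<sigma>: "\<sigma> 0 = \<gamma> a" "\<sigma> l = \<gamma> b"
      "\<And>s t. 0 \<le> s \<Longrightarrow> s \<le> t \<Longrightarrow> t \<le> l \<Longrightarrow> dist (\<sigma> s) (\<sigma> t) \<le> t - s"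
    using broken_line_curve[OF l] by auto
  have l0: "0 \<le> l" using broken_line_nonneg l .
  define k where "k = l / (b - a)"
  have k: "0 \<le> k" "k * (b - a) = l" using l0 assms by (auto simp: k_def)
  define \<rho> where "\<rho> t = \<sigma> (k * (t - a))" for t
  have lip: "dist (\<rho> s) (\<rho> t) \<le> k * (t - s)" if "a \<le> s" "s \<le> t" "t \<le> b" for s t
  proof -
    have "0 \<le> k * (s - a)" "k * (s - a) \<le> k * (t - a)" "k * (t - a) \<le> l"
      using that k(1) mult_left_mono[of "t - a" "b - a" k] by (auto simp: k(2) intro: mult_left_mono)
    from \<sigma>(3)[OF this] show ?thesis by (simp add: \<rho>_def algebra_simps)
  qed
  have "k-lipschitz_on {a..b} \<rho>"
  proof (rule lipschitz_onI)
    fix s t :: real assume "s \<in> {a..b}" "t \<in> {a..b}"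
    then show "dist (\<rho> s) (\<rho> t) \<le> k * dist s t"
      using lip[of s t] lip[of t s]
      by (cases "s \<le> t") (auto simp: dist_real_def dist_commute)
  qed (rule k)
  then have "continuous_on {a..b} \<rho>" by (rule lipschitz_on_continuous_on)
  then have "curve_length \<gamma> a b \<le> curve_length \<rho> a b"
    using assms(1) \<sigma> k by (auto simp: length_minimizing_def \<rho>_def)
  also have "\<dots> \<le> ereal (k * (b - a))" by (rule curve_length_le_Lipschitz) (rule lip)
  finally show "m \<le> l" using assms k by simp
qed

text \<open>Constant speed gives the Lipschitz bound, nonconstancy gives \<open>c > 0\<close>, and
  local minimality turns the bound into an equality on short intervals.\<close>

lemma closed_geodesic_imp_geodesic_line:
  fixes \<gamma> :: "real \<Rightarrow> doubled_disk"
  assumes "closed_geodesic \<gamma>"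
  obtains c where "geodesic_line \<gamma> c" "\<And>a b. a \<le> b \<Longrightarrow> curve_length \<gamma> a b = ereal (c * (b - a))"
proof -
  obtain c where c: "\<And>a b. a \<le> b \<Longrightarrow> curve_length \<gamma> a b = ereal (c * (b - a))"
    using assms unfolding closed_geodesic_def constant_speed_def by blast
  have le: "dist (\<gamma> a) (\<gamma> b) \<le> c * (b - a)" if "a \<le> b" for a b
    using dist_le_curve_length[OF that, of \<gamma>] c[OF that] by simp
  have "c \<noteq> 0"
  proof
    assume "c = 0"
    then have *: "\<gamma> a = \<gamma> b" if "a \<le> b" for a b
      using le[OF that] by simp
    have "\<gamma> a = \<gamma> 0" for a
      using *[of a 0] *[of 0 a] by (metis linear)
    then have "\<gamma> constant_on UNIV" by (auto simp: constant_on_def)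
    then show False using assms by (simp add: closed_geodesic_def)
  qed
  moreover have "0 \<le> c" using order_trans[OF zero_le_dist le[of 0 1]] by simp
  ultimately have "c > 0" by simp
  have "geodesic_line \<gamma> c"
  proof
    fix t
    obtain e where e: "e > 0" "\<And>a b. t - e < a \<Longrightarrow> a \<le> b \<Longrightarrow> b < t + e \<Longrightarrow> length_minimizing \<gamma> a b"
      using assms unfolding closed_geodesic_def locally_length_minimizing_def by blast
    have "dist (\<gamma> a) (\<gamma> b) = c * (b - a)" if "t - e < a" "a \<le> b" "b < t + e" for a b
    proof (cases "a = b")
      case False
      then have "a < b" using that by simp
      then have "c * (b - a) \<le> dist (\<gamma> a) (\<gamma> b)"
        using length_minimizing_le_dist[OF e(2)[OF that] _ c[OF that(2)]] by simp
      then show ?thesis using le[OF that(2)] by simp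
    qed simp
    then show "\<exists>e>0. \<forall>a b. t - e < a \<longrightarrow> a \<le> b \<longrightarrow> b < t + e \<longrightarrow>
          dist (\<gamma> a) (\<gamma> b) = c * (b - a)"
      using e(1) by blast
  qed fact+
  then show thesis using c that by blast
qed

section \<open>Linearly parametrized chords and ordered finite subdivisions\<close>

definition chord :: "(real \<Rightarrow> doubled_disk) \<Rightarrow> face \<Rightarrow> real \<Rightarrow> real \<Rightarrow> complex \<Rightarrow> complex \<Rightarrow> bool" where
  "chord \<gamma> f u v p q \<longleftrightarrow> u < v \<and> norm p = 1 \<and> norm q = 1 \<and> p \<noteq> q \<and>
     (\<forall>t\<in>{u..v}. \<gamma> t = on_face f (linepath p q ((t - u) / (v - u))))"

lemma chord_shift:
  assumes "chord \<gamma> f u v p q" "\<And>t. \<gamma> (t + s) = \<gamma> t"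
  shows "chord \<gamma> f (u + s) (v + s) p q"
proof -
  have "\<gamma> t = on_face f (linepath p q ((t - (u + s)) / (v - u)))" if "t \<in> {u + s..v + s}" for t
  proof -
    have "\<gamma> (t - s) = on_face f (linepath p q ((t - s - u) / (v - u)))"
      using assms(1) that by (auto simp: chord_def)
    then show ?thesis using assms(2)[of "t - s"] by (simp add: algebra_simps)
  qed
  then show ?thesis using assms(1) by (simp add: chord_def)
qed

lemma chord_at:
  assumes "chord \<gamma> f u v p q" "s \<in> {0..1}"
  shows "\<gamma> (u + s * (v - u)) = on_face f (linepath p q s)"
proof -
  have "0 \<le> s * (v - u)" "s * (v - u) \<le> v - u"
    using assms mult_right_mono[of s 1 "v - u"] by (auto simp: chord_def)
  then have "u + s * (v - u) \<in> {u..v}" by simp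
  moreover have "(u + s * (v - u) - u) / (v - u) = s" using assms(1) by (simp add: chord_def)
  ultimately show ?thesis using assms(1) unfolding chord_def by metis
qed

lemma chord_endpoints:
  assumes "chord \<gamma> f u v p q"
  shows "\<gamma> u = on_face f p" "\<gamma> v = on_face f q"
    "disk_proj (\<gamma> u) = p" "disk_proj (\<gamma> v) = q"
proof -
  show *: "\<gamma> u = on_face f p" "\<gamma> v = on_face f q"
    using chord_at[OF assms, of 0] chord_at[OF assms, of 1] by (auto simp: linepath_0' linepath_1')
  show "disk_proj (\<gamma> u) = p" "disk_proj (\<gamma> v) = q"
    using assms unfolding * by (auto simp: chord_def)
qed

text \<open>Lists \<open>A\<close> in increasing order, by removing the least element and putting it
  back in front with \<open>case_nat\<close>. It serves to cut a period at consecutive boundary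
  times.\<close>

lemma finite_subdivision:
  fixes A :: "'a::linorder set"
  assumes "finite A" "a \<in> A" "b \<in> A" "A \<subseteq> {a..b}"
  shows "\<exists>(n::nat) \<tau>. \<tau> 0 = a \<and> \<tau> n = b \<and>
    (\<forall>i<n. \<tau> i < \<tau> (Suc i) \<and> \<tau> i \<in> A \<and> \<tau> (Suc i) \<in> A \<and> A \<inter> {\<tau> i<..<\<tau> (Suc i)} = {})"
  using assms
proof (induction "card A" arbitrary: A a)
  case 0
  then show ?case by simp
next
  case (Suc m)
  show ?case
  proof (cases "a = b")
    case True
    then show ?thesis by (intro exI[of _ 0] exI[of _ "\<lambda>_. a"]) auto
  next
    case False
    define A' where "A' = A - {a}"
    define a' where "a' = Min A'"
    have A': "finite A'" "b \<in> A'" "card A' = m" "a \<notin> A'" "A = insert a A'"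
      using Suc False by (auto simp: A'_def)
    then have a': "a' \<in> A'" "A' \<subseteq> {a'..b}"
      using Suc.prems(4) unfolding a'_def by (auto intro!: Min_in)
    have "a < a'" using a'(1) A'(4,5) Suc.prems(4) by (metis atLeastAtMost_iff insertI2 order_le_less subsetD)
    obtain n \<tau> where \<tau>: "\<tau> 0 = a'" "\<tau> n = b"
      "\<forall>i<n. \<tau> i < \<tau> (Suc i) \<and> \<tau> i \<in> A' \<and> \<tau> (Suc i) \<in> A' \<and> A' \<inter> {\<tau> i<..<\<tau> (Suc i)} = {}"
      using Suc.hyps(1)[of A' a'] A' a' by metis
    define \<tau>' where "\<tau>' = case_nat a \<tau>"
    have "\<tau>' i < \<tau>' (Suc i) \<and> \<tau>' i \<in> A \<and> \<tau>' (Suc i) \<in> A \<and> A \<inter> {\<tau>' i<..<\<tau>' (Suc i)} = {}"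
      if "i < Suc n" for i
    proof (cases i)
      case 0
      then show ?thesis using \<tau>(1) \<open>a < a'\<close> a' A'(5) by (force simp: \<tau>'_def)
    next
      case (Suc j)
      then have "\<tau> j \<in> A'" using that \<tau>(3) by auto
      then have "a < \<tau> j" using a'(2) \<open>a < a'\<close> by fastforce
      then show ?thesis using \<tau>(3) A'(5) that Suc by (auto simp: \<tau>'_def)
    qed
    then show ?thesis using \<tau>(2)
      by (intro exI[of _ "Suc n"] exI[of _ \<tau>']) (simp add: \<tau>'_def)
  qed
qed

section \<open>Boundary times of a geodesic and the chords between them\<close>

context geodesic_line
begin

abbreviation (input) "\<zeta> t \<equiv> disk_proj (\<gamma> t)"

lemma continuous: "continuous_on A \<gamma>"
proof -
  have "c-lipschitz_on A \<gamma>"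
  proof (rule lipschitz_onI)
    fix s t :: real
    show "dist (\<gamma> s) (\<gamma> t) \<le> c * dist s t"
      using dist_le[of s t] dist_le[of t s]
      by (cases "s \<le> t") (auto simp: dist_real_def dist_commute)
  qed (use speed_pos in simp)
  then show ?thesis by (rule lipschitz_on_continuous_on)
qed

lemma continuous_proj: "continuous_on A (\<lambda>t. \<zeta> t)"
  by (rule continuous_on_compose2[OF continuous_on_disk_proj[of UNIV] continuous]) auto

lemma dist_proj_le: "a \<le> b \<Longrightarrow> dist (\<zeta> a) (\<zeta> b) \<le> c * (b - a)"
  using dist_le[of a b] dist_disk_proj_le[of "\<gamma> a" "\<gamma> b"] by linarith

text \<open>On one face the distance is Euclidean, so the projected endpoints are as far apart as
  the speed \<open>c\<close> permits; equality in the triangle inequality leaves only the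
  segment.\<close>

lemma same_face_straight:
  assumes "a < b" "dist (\<gamma> a) (\<gamma> b) = c * (b - a)"
    "\<gamma> a = on_face f (\<zeta> a)" "\<gamma> b = on_face f (\<zeta> b)" "a \<le> t" "t \<le> b"
  shows "\<zeta> t = linepath (\<zeta> a) (\<zeta> b) ((t - a) / (b - a))"
proof -
  have "dist (\<zeta> a) (\<zeta> b) = c * (b - a)"
    using dist_on_face[OF disk_proj_in_cball[of "\<gamma> a"] disk_proj_in_cball[of "\<gamma> b"], of f] assms
    by metis
  then have "\<zeta> t = linepath (\<zeta> a) (\<zeta> b) (c * (t - a) / (c * (t - a) + c * (b - t)))"
    using speed_pos assms
    by (intro between_points_eq_linepath dist_proj_le) (auto simp: algebra_simps)
  moreover have "c * (t - a) + c * (b - t) = c * (b - a)" by (simp add: algebra_simps)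
  ultimately show ?thesis using speed_pos by simp
qed

text \<open>Strict convexity of the disk; this yields the isolation and the existence of boundary
  times and the change of face at a corner.\<close>

lemma same_face_norm_less:
  assumes "a < b" "dist (\<gamma> a) (\<gamma> b) = c * (b - a)"
    "\<gamma> a = on_face f (\<zeta> a)" "\<gamma> b = on_face f (\<zeta> b)" "a < t" "t < b"
    "norm (\<zeta> a) \<le> r" "norm (\<zeta> b) \<le> r"
  shows "norm (\<zeta> t) < r"
proof -
  have "\<gamma> a \<noteq> \<gamma> b" using assms(1,2) speed_pos by auto
  then have "\<zeta> a \<noteq> \<zeta> b" using assms(3,4) by metis
  then show ?thesis
    using same_face_straight[OF assms(1-4), of t] assms norm_linepath_less[of "\<zeta> a" r "\<zeta> b"]
    by (simp add: field_simps)
qed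

definition boundary_times :: "real set" where
  "boundary_times = {t. norm (\<zeta> t) = 1}"

text \<open>Three boundary times \<open>a < s < b\<close> cannot share a minimizing window: the
  outer two lie on a common face, which forces \<open>\<gamma> s\<close> off the circle.
  Accumulation at \<open>t\<close> from one side would supply three.\<close>

lemma boundary_times_isolated:
  "\<exists>e>0. boundary_times \<inter> {t<..<t + e} = {}" "\<exists>e>0. boundary_times \<inter> {t - e<..<t} = {}"
proof -
  obtain e where e: "e > 0" "\<And>a b. t - e < a \<Longrightarrow> a \<le> b \<Longrightarrow> b < t + e \<Longrightarrow>
      dist (\<gamma> a) (\<gamma> b) = c * (b - a)"
    using local_isometry by blast
  have no: "False" if "a \<in> boundary_times" "b \<in> boundary_times" "s \<in> boundary_times" "a < s" "s < b"
     "t - e < a" "b < t + e" for a b s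
  proof -
    obtain f where f: "\<gamma> a = on_face f (\<zeta> a)" by (rule obtain_face)
    obtain g where g: "\<gamma> b = on_face g (\<zeta> b)" by (rule obtain_face)
    have "\<gamma> b = on_face f (\<zeta> b)"
      using g on_face_boundary[of "\<zeta> b"] that(2) by (metis (mono_tags) boundary_times_def mem_Collect_eq)
    then have "norm (\<zeta> s) < 1"
      using same_face_norm_less[of a b f s 1] f e that norm_disk_proj_le by auto
    then show False using that(3) by (simp add: boundary_times_def)
  qed
  show "\<exists>e>0. boundary_times \<inter> {t<..<t + e} = {}"
  proof (rule ccontr)
    assume "\<not> ?thesis"
    then have ex: "\<And>d. d > 0 \<Longrightarrow> \<exists>s\<in>boundary_times. t < s \<and> s < t + d" by fastforce
    obtain b where b: "b \<in> boundary_times" "t < b" "b < t + e" using ex[of e] e by auto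
    obtain s where s: "s \<in> boundary_times" "t < s" "s < b" using ex[of "b - t"] b by auto
    obtain a where a: "a \<in> boundary_times" "t < a" "a < s" using ex[of "s - t"] s by auto
    show False using no[of a b s] a b s e(1) by auto
  qed
  show "\<exists>e>0. boundary_times \<inter> {t - e<..<t} = {}"
  proof (rule ccontr)
    assume "\<not> ?thesis"
    then have ex: "\<And>d. d > 0 \<Longrightarrow> \<exists>s\<in>boundary_times. t - d < s \<and> s < t" by fastforce
    obtain a where a: "a \<in> boundary_times" "t - e < a" "a < t" using ex[of e] e by auto
    obtain s where s: "s \<in> boundary_times" "a < s" "s < t" using ex[of "t - a"] a by auto
    obtain b where b: "b \<in> boundary_times" "s < b" "b < t" using ex[of "t - s"] s by auto
    show False using no[of a b s] a b s e(1) by auto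
  qed
qed

lemma finite_boundary_times: "finite (boundary_times \<inter> {a..b})"
proof (rule ccontr)
  assume "infinite (boundary_times \<inter> {a..b})"
  then obtain x where x: "x islimpt boundary_times \<inter> {a..b}"
    using compact_eq_Bolzano_Weierstrass[of "{a..b}"] by (metis compact_Icc inf_le2)
  obtain d where d: "d > 0" "boundary_times \<inter> {x<..<x + d} = {}"
    using boundary_times_isolated(1) by blast
  obtain e where e: "e > 0" "boundary_times \<inter> {x - e<..<x} = {}"
    using boundary_times_isolated(2) by blast
  obtain y where "y \<in> boundary_times" "y \<noteq> x" "dist y x < min d e"
    using x d e unfolding islimpt_approachable by (metis IntD1 min_less_iff_conj)
  then show False using d(2) e(2) by (cases "x < y") (auto simp: dist_real_def abs_less_iff disjoint_iff)
qed

text \<open>Inside the interval the curve keeps one face and is locally straight with speed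
  \<open>c\<close>. Connectedness makes its velocity, then its affine offset, constant, and
  continuity covers the endpoints.\<close>

lemma between_boundary_times_chord:
  assumes "u < v" "u \<in> boundary_times" "v \<in> boundary_times" "boundary_times \<inter> {u<..<v} = {}"
  shows "\<exists>f. chord \<gamma> f u v (\<zeta> u) (\<zeta> v)"
proof -
  have int: "norm (\<zeta> t) < 1" if "u < t" "t < v" for t
    using that assms(4) norm_disk_proj_le[of "\<gamma> t"] by (force simp: boundary_times_def)
  obtain f where f: "\<And>t. u < t \<Longrightarrow> t < v \<Longrightarrow> \<gamma> t = on_face f (\<zeta> t)"
    using face_constant_on_interval[OF continuous assms(1) int] by blast
  have "\<exists>e>0. \<exists>w. norm w = c \<and> (\<forall>s. \<bar>s - t\<bar> < e \<longrightarrow> u < s \<and> s < v \<and> \<zeta> s = \<zeta> t + (s - t) *\<^sub>R w)"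
    if t: "u < t" "t < v" for t
  proof -
    obtain e where e: "e > 0" "\<And>a b. t - e < a \<Longrightarrow> a \<le> b \<Longrightarrow> b < t + e \<Longrightarrow>
      dist (\<gamma> a) (\<gamma> b) = c * (b - a)"
      using local_isometry by blast
    define d where "d = min e (min (t - u) (v - t)) / 2"
    have d: "0 < d" "d < e" "u < t - d" "t + d < v" using e(1) t by (auto simp: d_def min_def field_simps)
    let ?a = "t - d" and ?b = "t + d"
    define w where "w = (1 / (2 * d)) *\<^sub>R (\<zeta> ?b - \<zeta> ?a)"
    have ab: "dist (\<gamma> ?a) (\<gamma> ?b) = c * (?b - ?a)" using e(2)[of ?a ?b] d by simp
    have str: "\<zeta> s = \<zeta> ?a + (s - ?a) *\<^sub>R w" if "?a \<le> s" "s \<le> ?b" for s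
      using same_face_straight[OF _ ab f f that] d
      by (simp add: linepath_def w_def algebra_simps add_divide_distrib diff_divide_distrib)
    have "\<zeta> s = \<zeta> t + (s - t) *\<^sub>R w" if "?a \<le> s" "s \<le> ?b" for s
      using str[OF that] str[of t] d by (simp add: algebra_simps)
    moreover have "norm w = c"
    proof -
      have "dist (\<zeta> ?a) (\<zeta> ?b) = c * (?b - ?a)"
        using ab f[of ?a] f[of ?b] d
          dist_on_face[OF disk_proj_in_cball[of "\<gamma> ?a"] disk_proj_in_cball[of "\<gamma> ?b"], of f] by simp
      then show ?thesis using d unfolding w_def by (simp add: dist_norm norm_minus_commute)
    qed
    moreover have "u < s \<and> s < v \<and> ?a \<le> s \<and> s \<le> ?b" if "\<bar>s - t\<bar> < d" for s
      using that d by (auto simp: abs_less_iff)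
    ultimately show ?thesis using d(1) by blast
  qed
  then obtain e w where ew: "\<And>t. u < t \<Longrightarrow> t < v \<Longrightarrow> e t > 0" "\<And>t. u < t \<Longrightarrow> t < v \<Longrightarrow> norm (w t) = c"
    "\<And>t s. u < t \<Longrightarrow> t < v \<Longrightarrow> \<bar>s - t\<bar> < e t \<Longrightarrow> u < s \<and> s < v \<and> \<zeta> s = \<zeta> t + (s - t) *\<^sub>R w t"
    by metis
  have nbhd: "\<forall>\<^sub>F s in at t within {u<..<v}. \<bar>s - t\<bar> < e t" if "t \<in> {u<..<v}" for t
    using ew(1)[of t] that unfolding eventually_at by (force simp: dist_real_def)
  have wloc: "w s = w t" if t: "u < t" "t < v" and s: "\<bar>s - t\<bar> < e t" for s t
  proof -
    have s': "u < s" "s < v" using ew(3)[OF t s] by auto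
    obtain \<mu> where \<mu>: "0 < \<mu>" "\<mu> < e s" "\<mu> < e t - \<bar>s - t\<bar>"
      using ew(1)[OF s'] s field_lbound_gt_zero[of "e s" "e t - \<bar>s - t\<bar>"] by auto
    \<comment> \<open>A third time in both neighbourhoods: the increment from \<open>s\<close> to
      \<open>r\<close> can be computed with either velocity.\<close>
    define r where "r = s + \<mu>"
    have r: "r > s" "\<bar>r - s\<bar> < e s" "\<bar>r - t\<bar> < e t"
      using \<mu> unfolding r_def by arith+
    have "(r - s) *\<^sub>R w s = (r - s) *\<^sub>R w t"
      using ew(3)[OF s' r(2)] ew(3)[OF t r(3)] ew(3)[OF t s] by (simp add: algebra_simps)
    then show ?thesis using r(1) by simp
  qed
  define m where "m = (u + v) / 2"
  have m: "m \<in> {u<..<v}" using assms(1) by (auto simp: m_def)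
  have wc: "w t = w m" if "t \<in> {u<..<v}" for t
  proof (rule connected_local_const[OF connected_Ioo that m], rule ballI)
    fix t assume t: "t \<in> {u<..<v}"
    show "\<forall>\<^sub>F s in at t within {u<..<v}. w t = w s"
      using nbhd[OF t]
    proof eventually_elim
      case (elim s)
      then show ?case using wloc[of t s] t by simp
    qed
  qed
  have gc: "\<zeta> t - t *\<^sub>R w m = \<zeta> m - m *\<^sub>R w m" if "t \<in> {u<..<v}" for t
  proof (rule connected_local_const[OF connected_Ioo that m, where f = "\<lambda>t. \<zeta> t - t *\<^sub>R w m"], rule ballI)
    fix t assume t: "t \<in> {u<..<v}"
    show "\<forall>\<^sub>F s in at t within {u<..<v}. \<zeta> t - t *\<^sub>R w m = \<zeta> s - s *\<^sub>R w m"
      using nbhd[OF t]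
    proof eventually_elim
      case (elim s)
      then show ?case using ew(3)[of t s] t wc[OF t] by (auto simp: algebra_simps)
    qed
  qed
  have aff: "\<zeta> t = \<zeta> m + (t - m) *\<^sub>R w m" if "t \<in> {u..v}" for t
  proof (rule continuous_constant_on_closure[where S = "{u<..<v}" and f = "\<lambda>t. \<zeta> t - (\<zeta> m + (t - m) *\<^sub>R w m)" and a = 0, THEN eq_iff_diff_eq_0[THEN iffD2]])
    show "continuous_on (closure {u<..<v}) (\<lambda>t. \<zeta> t - (\<zeta> m + (t - m) *\<^sub>R w m))"
      by (intro continuous_intros continuous_proj)
    show "\<And>t. t \<in> {u<..<v} \<Longrightarrow> \<zeta> t - (\<zeta> m + (t - m) *\<^sub>R w m) = 0"
      using gc by (auto simp: algebra_simps)
    show "t \<in> closure {u<..<v}" using that assms(1) by simp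
  qed
  have uv: "\<zeta> v = \<zeta> u + (v - u) *\<^sub>R w m"
  proof -
    have "\<zeta> v = \<zeta> u - (u - m) *\<^sub>R w m + (v - m) *\<^sub>R w m"
      using aff[of u] aff[of v] assms(1) by simp
    then show ?thesis by (simp add: algebra_simps)
  qed
  have "w m \<noteq> 0" using ew(2)[of m] m speed_pos by auto
  then have ne: "\<zeta> u \<noteq> \<zeta> v" using uv assms(1) by auto
  have lin: "\<zeta> t = linepath (\<zeta> u) (\<zeta> v) ((t - u) / (v - u))" if "t \<in> {u..v}" for t
  proof -
    have "\<zeta> t = \<zeta> u + (t - u) *\<^sub>R w m"
    proof -
      have "\<zeta> t = \<zeta> u - (u - m) *\<^sub>R w m + (t - m) *\<^sub>R w m"
        using aff[of u] aff[OF that] assms(1) by simp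
      then show ?thesis by (simp add: algebra_simps)
    qed
    also have "(t - u) *\<^sub>R w m = ((t - u) / (v - u)) *\<^sub>R (\<zeta> v - \<zeta> u)"
      using uv assms(1) by simp
    finally show ?thesis by (simp add: linepath_def algebra_simps)
  qed
  \<comment> \<open>The endpoints are boundary points and hence lie on \<open>f\<close> too.\<close>
  have face: "\<gamma> t = on_face f (\<zeta> t)" if "t \<in> {u..v}" for t
  proof (cases "t = u \<or> t = v")
    case True
    obtain g where "\<gamma> t = on_face g (\<zeta> t)" by (rule obtain_face)
    moreover have "norm (\<zeta> t) = 1" using True assms(2,3) by (auto simp: boundary_times_def)
    ultimately show ?thesis using on_face_boundary by metis
  qed (use that f in auto)
  have "\<forall>t\<in>{u..v}. \<gamma> t = on_face f (linepath (\<zeta> u) (\<zeta> v) ((t - u) / (v - u)))"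
    using face lin by metis
  moreover have "norm (\<zeta> u) = 1" "norm (\<zeta> v) = 1"
    using assms(2,3) by (auto simp: boundary_times_def)
  ultimately show ?thesis unfolding chord_def using assms(1) ne by blast
qed

text \<open>Local isometry covers only a short piece at \<open>u\<close>; the linear parametrization
  carries the speed found there over to the whole chord.\<close>

lemma chord_speed:
  assumes "chord \<gamma> f u v p q"
  shows "dist p q = c * (v - u)"
proof -
  obtain e where e: "e > 0" "\<And>a b. u - e < a \<Longrightarrow> a \<le> b \<Longrightarrow> b < u + e \<Longrightarrow>
      dist (\<gamma> a) (\<gamma> b) = c * (b - a)"
    using local_isometry by blast
  have uv: "u < v" and pq: "p \<in> cball 0 1" "q \<in> cball 0 1"
    and lin: "\<And>t. t \<in> {u..v} \<Longrightarrow> \<gamma> t = on_face f (linepath p q ((t - u) / (v - u)))"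
    using assms by (auto simp: chord_def)
  obtain d where d: "0 < d" "d < e" "d < v - u"
    using field_lbound_gt_zero[OF e(1), of "v - u"] uv by auto
  have "c * d = dist (\<gamma> u) (\<gamma> (u + d))" using e(2)[of u "u + d"] e(1) d by simp
  also have "\<dots> = dist (linepath p q 0) (linepath p q (d / (v - u)))"
    using d lin[of u] lin[of "u + d"] linepath_in_cball[OF pq, of "d / (v - u)"]
      dist_on_face[OF pq(1), of "linepath p q (d / (v - u))" f]
    by (simp add: linepath_0')
  also have "\<dots> = d / (v - u) * dist p q"
    using dist_linepath[of p q 0 "d / (v - u)"] d by simp
  finally have "c * d * (v - u) = d * dist p q" using uv by simp
  then have "d * (dist p q - c * (v - u)) = 0" by algebra
  then show ?thesis using d(1) by simp
qed

text \<open>A short arc around \<open>v\<close> is minimizing. On one face it would be straight and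
  keep \<open>\<gamma> v\<close> off the circle; on opposite faces, detours through other boundary
  points give the reflection law, hence chords of equal length and duration.\<close>

lemma consecutive_chords:
  assumes uv: "chord \<gamma> f u v p q" and vw: "chord \<gamma> g v w q r"
  shows "f \<noteq> g" "p * r = q\<^sup>2" "w - v = v - u"
proof -
  obtain e where e: "e > 0" "\<And>a b. v - e < a \<Longrightarrow> a \<le> b \<Longrightarrow> b < v + e \<Longrightarrow>
      dist (\<gamma> a) (\<gamma> b) = c * (b - a)"
    using local_isometry by blast
  have ord: "u < v" "v < w" and n: "norm p = 1" "norm q = 1" "norm r = 1" "p \<noteq> q" "r \<noteq> q"
    using uv vw by (auto simp: chord_def)
  obtain d' where d': "0 < d'" "d' < v - u" "d' < w - v"
    using field_lbound_gt_zero[of "v - u" "w - v"] ord by auto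
  obtain d where d: "0 < d" "d < e" "d < v - u" "d < w - v"
    using field_lbound_gt_zero[OF d'(1) e(1)] d' by auto
  \<comment> \<open>The relative positions on the two chords at times \<open>v - d\<close> and
    \<open>v + d\<close>.\<close>
  define s t where "s = 1 - d / (v - u)" "t = d / (w - v)"
  have st: "0 < s" "s < 1" "0 < t" "t < 1" "u + s * (v - u) = v - d" "v + t * (w - v) = v + d"
    using d ord by (auto simp: s_t_def field_simps)
  let ?x = "linepath p q s" and ?y = "linepath q r t"
  have x: "\<gamma> (v - d) = on_face f ?x" and y: "\<gamma> (v + d) = on_face g ?y"
    using chord_at[OF uv, of s] chord_at[OF vw, of t] st by auto
  have cb: "?x \<in> cball 0 1" "?y \<in> cball 0 1"
    using n st by (auto intro!: linepath_in_cball[unfolded mem_cball dist_0_norm])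
  have dist: "dist (\<gamma> (v - d)) (\<gamma> (v + d)) = c * (2 * d)"
    using e(2)[of "v - d" "v + d"] d by simp
  show "f \<noteq> g"
  proof
    assume "f = g"
    then have "norm (\<zeta> v) < 1"
      using same_face_norm_less[of "v - d" "v + d" f v 1] dist x y cb d norm_disk_proj_le by simp
    then show False using chord_endpoints(4)[OF uv] n by simp
  qed
  have sp: "dist p q = c * (v - u)" "dist r q = c * (w - v)"
    using chord_speed[OF uv] chord_speed[OF vw] by (auto simp: dist_commute)
  have xy: "?x = q + (c * d / dist p q) *\<^sub>R (p - q)" "?y = q + (c * d / dist r q) *\<^sub>R (r - q)"
  proof -
    have "c * d / dist p q = d / (v - u)" "c * d / dist r q = d / (w - v)"
      using speed_pos unfolding sp by auto
    then show "?x = q + (c * d / dist p q) *\<^sub>R (p - q)" "?y = q + (c * d / dist r q) *\<^sub>R (r - q)"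
      by (simp_all add: linepath_def s_t_def algebra_simps)
  qed
  show refl: "p * r = q\<^sup>2"
  proof (rule reflection_law[of p q r "c * d"])
    fix z :: complex assume "norm z = 1"
    then show "2 * (c * d) \<le> dist (q + (c * d / dist p q) *\<^sub>R (p - q)) z
        + dist (q + (c * d / dist r q) *\<^sub>R (r - q)) z"
      using dist_opposite_faces_le[OF cb, of z f g] dist x y
      unfolding xy[symmetric] by (simp add: dist_commute[of z])
  qed (use n speed_pos d in auto)
  \<comment> \<open>The norms of the two sides are the chord lengths, as \<open>p\<close> and
    \<open>q\<close> are unit vectors.\<close>
  have "q * (p - q) = p * (q - r)" using refl by (simp add: algebra_simps power2_eq_square)
  then have "norm (q * (p - q)) = norm (p * (q - r))" by simp
  then have "dist p q = dist r q" using n by (simp add: norm_mult dist_norm norm_minus_commute)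
  then show "w - v = v - u" using sp speed_pos by simp
qed

end

section \<open>Closed geodesics as regular closed broken lines\<close>

locale closed_geodesic_line = geodesic_line +
  assumes periodic: "\<gamma> (t + 2 * pi) = \<gamma> t"
begin

lemma periodic_nat: "\<gamma> (t + 2 * pi * real m) = \<gamma> t"
proof (induction m)
  case (Suc m)
  then show ?case using periodic[of "t + 2 * pi * real m"] by (simp add: algebra_simps)
qed simp

lemma periodic_int: "\<gamma> (t + 2 * pi * of_int k) = \<gamma> t"
proof (cases "k \<ge> 0")
  case True
  then show ?thesis using periodic_nat[of t "nat k"] by simp
next
  case False
  then show ?thesis using periodic_nat[of "t + 2 * pi * of_int k" "nat (- k)"] by simp
qed

text \<open>By periodicity \<open>norm (\<zeta> t)\<close> has a maximum. Off the circle the curve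
  would be straight on one face around it, contradicting strict convexity.\<close>

lemma boundary_times_nonempty: "boundary_times \<noteq> {}"
proof
  assume "boundary_times = {}"
  then have int: "norm (\<zeta> t) < 1" for t
    using norm_disk_proj_le[of "\<gamma> t"] by (auto simp: boundary_times_def order_less_le)
  have "\<exists>t0\<in>{0..2 * pi}. \<forall>t\<in>{0..2 * pi}. norm (\<zeta> t) \<le> norm (\<zeta> t0)"
    by (intro continuous_attains_sup continuous_on_norm continuous_proj) auto
  then obtain t0 where t0: "\<And>t. t \<in> {0..2 * pi} \<Longrightarrow> norm (\<zeta> t) \<le> norm (\<zeta> t0)" by blast
  have max: "norm (\<zeta> t) \<le> norm (\<zeta> t0)" for t
  proof -
    define t' where "t' = t + 2 * pi * of_int (- \<lfloor>t / (2 * pi)\<rfloor>)"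
    have "2 * pi * of_int \<lfloor>t / (2 * pi)\<rfloor> \<le> 2 * pi * (t / (2 * pi))"
      "2 * pi * (t / (2 * pi)) \<le> 2 * pi * (of_int \<lfloor>t / (2 * pi)\<rfloor> + 1)"
      by (intro mult_left_mono; simp; linarith)+
    then have "t' \<in> {0..2 * pi}" by (simp add: t'_def algebra_simps)
    then show ?thesis using t0[of t'] periodic_int[of t "- \<lfloor>t / (2 * pi)\<rfloor>"] unfolding t'_def by metis
  qed
  obtain e where e: "e > 0" "\<And>a b. t0 - e < a \<Longrightarrow> a \<le> b \<Longrightarrow> b < t0 + e \<Longrightarrow>
      dist (\<gamma> a) (\<gamma> b) = c * (b - a)"
    using local_isometry by blast
  obtain f where f: "\<And>t. t0 - e < t \<Longrightarrow> t < t0 + e \<Longrightarrow> \<gamma> t = on_face f (\<zeta> t)"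
    using face_constant_on_interval[OF continuous _ int, of "t0 - e" "t0 + e"] e(1) by auto
  have "norm (\<zeta> t0) < norm (\<zeta> t0)"
    by (rule same_face_norm_less[of "t0 - e / 2" "t0 + e / 2" f t0])
      (use e(1) e(2)[of "t0 - e / 2" "t0 + e / 2"] in \<open>auto intro!: max f\<close>)
  then show False by simp
qed

text \<open>The condition on \<open>b n\<close> is supplied by the end of the last chord, which
  exists because \<open>\<tau> n = \<tau> 0 + 2 * pi\<close> excludes \<open>n = 0\<close>.\<close>

lemma composed_of_segments_iff:
  "composed_of_segments \<gamma> n \<longleftrightarrow> (\<exists>\<tau> b f. \<tau> n = \<tau> 0 + 2 * pi \<and> f n = f 0 \<and>
     (\<forall>i<n. chord \<gamma> (f i) (\<tau> i) (\<tau> (Suc i)) (b i) (b (Suc i)) \<and> f i \<noteq> f (Suc i)))"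
proof -
  have eq: "(\<forall>i\<le>n. b i \<in> sphere 0 1) \<and> (\<forall>i<n. \<tau> i < \<tau> (Suc i) \<and> b i \<noteq> b (Suc i) \<and> f i \<noteq> f (Suc i) \<and>
           (\<forall>t\<in>{\<tau> i..\<tau> (Suc i)}.
              \<gamma> t = on_face (f i) (linepath (b i) (b (Suc i)) ((t - \<tau> i) / (\<tau> (Suc i) - \<tau> i)))))
    \<longleftrightarrow> (\<forall>i<n. chord \<gamma> (f i) (\<tau> i) (\<tau> (Suc i)) (b i) (b (Suc i)) \<and> f i \<noteq> f (Suc i))"
    (is "?L \<longleftrightarrow> ?R")
    if "\<tau> n = \<tau> 0 + 2 * pi" for \<tau> b f
  proof
    assume ?L
    then show ?R by (auto simp: chord_def)
  next
    assume R: ?R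
    have "n \<noteq> 0" using that by (intro notI) auto
    then obtain m where m: "n = Suc m" using not0_implies_Suc by blast
    have "norm (b i) = 1" if "i \<le> n" for i
    proof (cases "i = n")
      case True
      then show ?thesis using R m by (auto simp: chord_def)
    qed (use R that in \<open>auto simp: chord_def\<close>)
    then show ?L using R by (simp add: chord_def)
  qed
  then show ?thesis
    unfolding composed_of_segments_def by (intro ex_cong1 conj_cong refl) (rule eq)
qed

text \<open>One period, started at a boundary time, is cut at all its boundary times.\<close>

lemma composed_of_segments_exists: "\<exists>n. composed_of_segments \<gamma> n"
proof -
  obtain u where u: "u \<in> boundary_times" using boundary_times_nonempty by blast
  then have u': "u + 2 * pi \<in> boundary_times" by (simp add: boundary_times_def periodic)
  let ?A = "boundary_times \<inter> {u..u + 2 * pi}"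
  obtain n \<tau> where \<tau>: "\<tau> 0 = u" "\<tau> n = u + 2 * pi"
    "\<And>i. i < n \<Longrightarrow> \<tau> i < \<tau> (Suc i) \<and> \<tau> i \<in> ?A \<and> \<tau> (Suc i) \<in> ?A \<and> ?A \<inter> {\<tau> i<..<\<tau> (Suc i)} = {}"
    using finite_subdivision[OF finite_boundary_times, of u u "u + 2 * pi" "u + 2 * pi"] u u' by auto
  have "\<exists>f. chord \<gamma> f (\<tau> i) (\<tau> (Suc i)) (\<zeta> (\<tau> i)) (\<zeta> (\<tau> (Suc i)))" if "i < n" for i
  proof (rule between_boundary_times_chord)
    have "{\<tau> i<..<\<tau> (Suc i)} \<subseteq> {u..u + 2 * pi}" using \<tau>(3)[OF that] by auto
    then show "boundary_times \<inter> {\<tau> i<..<\<tau> (Suc i)} = {}" using \<tau>(3)[OF that] by blast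
  qed (use \<tau>(3)[OF that] in auto)
  then obtain f where f: "\<And>i. i < n \<Longrightarrow> chord \<gamma> (f i) (\<tau> i) (\<tau> (Suc i)) (\<zeta> (\<tau> i)) (\<zeta> (\<tau> (Suc i)))"
    by metis
  \<comment> \<open>Only faces with index below \<open>n\<close> come from chords; closing up
    demands the value \<open>f 0\<close> at \<open>n\<close>.\<close>
  define g where "g i = (if i < n then f i else f 0)" for i
  have "g i \<noteq> g (Suc i)" if "i < n" for i
  proof (cases "Suc i = n")
    case True
    \<comment> \<open>At the closing corner the next chord is the first one, a period later.\<close>
    have "chord \<gamma> (f 0) (\<tau> n) (\<tau> 1 + 2 * pi) (\<zeta> (\<tau> n)) (\<zeta> (\<tau> 1))"
      using chord_shift[OF f[of 0], of "2 * pi"] that \<tau>(1,2) periodic by simp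
    then show ?thesis using consecutive_chords(1)[OF f[OF that]] True by (simp add: g_def)
  next
    case False
    then show ?thesis
      using consecutive_chords(1)[OF f[OF that] f[of "Suc i"]] that by (simp add: g_def)
  qed
  then show ?thesis
    unfolding composed_of_segments_iff using f \<tau>(1,2)
    by (intro exI[of _ n] exI[of _ \<tau>] exI[of _ "\<lambda>i. \<zeta> (\<tau> i)"] exI[of _ g]) (simp add: g_def)
qed

text \<open>Continuing the indices over all naturals makes the closing corner like any other; equal
  durations then put the vertex times in arithmetic progression.\<close>

lemma composed_of_segments_regular:
  assumes "composed_of_segments \<gamma> n"
  obtains h T b f where "n \<ge> 2" "h = 2 * pi / real n"
    "\<And>i::nat. chord \<gamma> (f i) (T + real i * h) (T + real (Suc i) * h) (b i) (b (Suc i))"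
    "\<And>i. b i * b (Suc (Suc i)) = (b (Suc i))\<^sup>2" "\<And>i. f i \<noteq> f (Suc i)"
proof -
  obtain \<tau> b f where \<tau>: "\<tau> n = \<tau> 0 + 2 * pi" and f: "f n = f 0" and
    ch: "\<And>i. i < n \<Longrightarrow> chord \<gamma> (f i) (\<tau> i) (\<tau> (Suc i)) (b i) (b (Suc i))" and
    ne: "\<And>i. i < n \<Longrightarrow> f i \<noteq> f (Suc i)"
    using assms unfolding composed_of_segments_iff by blast
  have "n \<noteq> 0" using \<tau> by (intro notI) auto
  \<comment> \<open>A single chord would have to differ in face from itself.\<close>
  moreover have "n \<noteq> 1" using ne[of 0] f by auto
  ultimately have n: "n \<ge> 2" by simp
  have bn: "b n = b 0"
  proof -
    have "b n = \<zeta> (\<tau> n)" using chord_endpoints(4)[OF ch[of "n - 1"]] n by simp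
    also have "\<dots> = b 0" using chord_endpoints(3)[OF ch[of 0]] n \<tau> periodic by simp
    finally show ?thesis .
  qed
  \<comment> \<open>A period is added each time the index wraps around.\<close>
  define T where "T i = \<tau> (i mod n) + 2 * pi * real (i div n)" for i
  define B where "B i = b (i mod n)" for i
  define F where "F i = f (i mod n)" for i
  have C: "chord \<gamma> (F i) (T i) (T (Suc i)) (B i) (B (Suc i))" for i
  proof -
    have r: "i mod n < n" using n by simp
    have "T (Suc i) = \<tau> (Suc (i mod n)) + 2 * pi * real (i div n)" "B (Suc i) = b (Suc (i mod n))"
      using \<tau> bn by (auto simp: T_def B_def F_def mod_Suc div_Suc algebra_simps)
    then show ?thesis
      using chord_shift[OF ch[OF r] periodic_nat, of "i div n"] by (simp add: T_def B_def F_def)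
  qed
  have step: "T (Suc (Suc i)) - T (Suc i) = T (Suc i) - T i" for i
    by (rule consecutive_chords(3)[OF C C])
  define h where "h = T 1 - T 0"
  have "T (Suc i) - T i = h" for i
    by (induction i) (use step in \<open>auto simp: h_def\<close>)
  then have T: "T i = T 0 + real i * h" for i
    by (induction i) (auto simp: algebra_simps)
  have "T n = T 0 + 2 * pi" using n by (simp add: T_def B_def F_def)
  then have "h = 2 * pi / real n" using T[of n] n by (simp add: field_simps)
  then show thesis
    using that[OF n, of h F "T 0" B] C consecutive_chords(1,2)[OF C C] unfolding T[symmetric] by blast
qed

lemma one_over_k_iff:
  assumes "curve_length \<gamma> 0 (2 * pi) = ereal (c * (2 * pi))" "k \<ge> 1"
  shows "one_over_k k \<gamma> \<longleftrightarrow> (\<forall>t. dist (\<gamma> t) (\<gamma> (t + 2 * pi / real k)) = c * (2 * pi / real k))"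
  using assms by (simp add: one_over_k_def)

text \<open>\<open>\<gamma> t\<close> and \<open>\<gamma> (t + h)\<close> have the same relative
  position on consecutive chords of opposite faces: the ellipse estimate bounds their distance
  below, the speed above.\<close>

lemma one_over_num_segments:
  assumes "composed_of_segments \<gamma> n"
  shows "dist (\<gamma> t) (\<gamma> (t + 2 * pi / real n)) = c * (2 * pi / real n)"
proof -
  obtain h T b f where n: "n \<ge> 2" and h: "h = 2 * pi / real n"
    and C: "\<And>i::nat. chord \<gamma> (f i) (T + real i * h) (T + real (Suc i) * h) (b i) (b (Suc i))"
    and b: "\<And>i. b i * b (Suc (Suc i)) = (b (Suc i))\<^sup>2" and f: "\<And>i. f i \<noteq> f (Suc i)"
    using composed_of_segments_regular[OF assms] by metis
  have h0: "h > 0" using n h by simp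
  \<comment> \<open>Whole periods move \<open>t\<close> to a time not before \<open>T\<close>, since
    chords are indexed by naturals; \<open>i\<close> and \<open>s\<close> are the integer and
    fractional parts of the number of chords since \<open>T\<close>.\<close>
  define k where "k = \<lceil>(T - t) / (2 * pi)\<rceil>"
  define x where "x = (t + 2 * pi * of_int k - T) / h"
  have "(T - t) / (2 * pi) \<le> of_int k" by (simp add: k_def)
  then have "x \<ge> 0" using h0 by (simp add: x_def field_simps)
  define i s where "i = nat \<lfloor>x\<rfloor>" and "s = x - real i"
  have s: "s \<in> {0..1}" using \<open>x \<ge> 0\<close> by (simp add: i_def s_def) linarith
  have tx: "t + 2 * pi * of_int k = T + real i * h + s * h"
    using h0 by (simp add: s_def x_def field_simps)
  have *: "\<gamma> (T + real j * h + s * h) = on_face (f j) (linepath (b j) (b (Suc j)) s)" for j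
    using chord_at[OF C[of j] s] by (simp add: algebra_simps)
  have "\<gamma> t = on_face (f i) (linepath (b i) (b (Suc i)) s)"
    using *[of i] tx periodic_int[of t k] by simp
  moreover have "\<gamma> (t + h) = on_face (f (Suc i)) (linepath (b (Suc i)) (b (Suc (Suc i))) s)"
  proof -
    have "t + h + 2 * pi * of_int k = T + real (Suc i) * h + s * h"
      using tx by (simp add: algebra_simps)
    then show ?thesis using *[of "Suc i"] periodic_int[of "t + h" k] by simp
  qed
  moreover have nb: "norm (b j) = 1" for j using C[of j] by (simp add: chord_def)
  moreover have "dist (b i) (b (Suc i)) = c * h"
    using chord_speed[OF C[of i]] by (simp add: algebra_simps)
  ultimately have "c * h \<le> dist (\<gamma> t) (\<gamma> (t + h))"
    using two_chords_dist[OF nb nb nb b, of _ i s] s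
    by (auto intro!: dist_opposite_faces_ge f linepath_in_cball[unfolded mem_cball dist_0_norm])
  moreover have "dist (\<gamma> t) (\<gamma> (t + h)) \<le> c * h" using dist_le[of t "t + h"] h0 by simp
  ultimately show ?thesis unfolding h by simp
qed

text \<open>The start \<open>b 0\<close> lies on both faces, so the distance is Euclidean. Equality
  would place the corner \<open>b 1\<close> strictly inside a segment of the disk, hence off the
  circle.\<close>

lemma not_one_over_less_num_segments:
  assumes "composed_of_segments \<gamma> n" "1 \<le> k" "k < n"
  shows "\<exists>t. dist (\<gamma> t) (\<gamma> (t + 2 * pi / real k)) \<noteq> c * (2 * pi / real k)"
proof -
  obtain h T b f where n: "n \<ge> 2" and h: "h = 2 * pi / real n"
    and C: "\<And>i::nat. chord \<gamma> (f i) (T + real i * h) (T + real (Suc i) * h) (b i) (b (Suc i))"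
    using composed_of_segments_regular[OF assms(1)] by metis
  have C0: "chord \<gamma> (f 0) T (T + h) (b 0) (b 1)" using C[of 0] by simp
  then have nb: "norm (b 0) = 1" "norm (b 1) = 1" by (auto simp: chord_def)
  define l where "l = 2 * pi / real k"
  have hl: "0 < h" "h < l" using assms n unfolding h l_def by (auto simp: field_simps)
  let ?z = "\<zeta> (T + l)"
  have "dist (\<gamma> T) (\<gamma> (T + l)) \<noteq> c * l"
  proof
    assume eq: "dist (\<gamma> T) (\<gamma> (T + l)) = c * l"
    obtain g where "\<gamma> (T + l) = on_face g ?z" by (rule obtain_face)
    then have d: "dist (b 0) ?z = c * h + c * (l - h)"
      using eq dist_on_face_boundary[OF nb(1) disk_proj_in_cball, of "f 0" g "\<gamma> (T + l)"]
        chord_endpoints(1)[OF C0] by (simp add: algebra_simps)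
    have "dist (b 0) (b 1) \<le> c * h" using chord_speed[OF C0] by simp
    moreover have "dist (b 1) ?z \<le> c * (l - h)"
      using dist_proj_le[of "T + h" "T + l"] chord_endpoints(4)[OF C0] hl by simp
    ultimately have "b 1 = linepath (b 0) ?z (c * h / (c * h + c * (l - h)))"
      by (rule between_points_eq_linepath[OF _ _ d]) (use speed_pos hl in \<open>simp add: algebra_simps\<close>)
    also have "c * h + c * (l - h) = c * l" by (simp add: algebra_simps)
    finally have "b 1 = linepath (b 0) ?z (h / l)" using speed_pos by simp
    moreover have "b 0 \<noteq> ?z"
    proof
      assume "b 0 = ?z"
      then have "c * l = 0" using d by (simp add: algebra_simps)
      then show False using speed_pos hl by simp
    qed
    ultimately have "norm (b 1) < 1"
      using norm_linepath_less[of "b 0" 1 ?z "h / l"] nb(1) norm_disk_proj_le[of "\<gamma> (T + l)"] hl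
      by simp
    then show False using nb(2) by simp
  qed
  then show ?thesis unfolding l_def by blast
qed

end

section \<open>The minimizing index\<close>

text \<open>The first two conjuncts ensure that \<open>THE\<close> in \<open>num_segments\<close>
  and \<open>LEAST\<close> in \<open>minind\<close> denote actual values.\<close>

theorem theorem1p1:
  fixes \<gamma> :: "real \<Rightarrow> doubled_disk"
  assumes "closed_geodesic \<gamma>"
  shows "(\<exists>!n. composed_of_segments \<gamma> n) \<and> (\<exists>k\<ge>2. one_over_k k \<gamma>) \<and>
         minind \<gamma> = num_segments \<gamma>"
proof -
  obtain c where c: "geodesic_line \<gamma> c"
    and len: "\<And>a b. a \<le> b \<Longrightarrow> curve_length \<gamma> a b = ereal (c * (b - a))"
    using closed_geodesic_imp_geodesic_line[OF assms] by metis
  interpret geodesic_line \<gamma> c by (rule c)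
  interpret closed_geodesic_line \<gamma> c
    by standard (use assms in \<open>simp add: closed_geodesic_def closed_curve_def\<close>)
  have iff: "one_over_k k \<gamma> \<longleftrightarrow> (\<forall>t. dist (\<gamma> t) (\<gamma> (t + 2 * pi / real k)) = c * (2 * pi / real k))"
    if "k \<ge> 2" for k
    using one_over_k_iff[of k] len[of 0 "2 * pi"] that by simp
  \<comment> \<open>Stated for every segment count, so that uniqueness follows: all of them equal
    \<open>minind \<gamma>\<close>.\<close>
  have *: "n \<ge> 2 \<and> one_over_k n \<gamma> \<and> minind \<gamma> = n" if n: "composed_of_segments \<gamma> n" for n
  proof -
    have n2: "n \<ge> 2" using composed_of_segments_regular[OF n] by metis
    moreover have "one_over_k n \<gamma>" using iff[OF n2] one_over_num_segments[OF n] by blast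
    moreover have "minind \<gamma> = n"
      unfolding minind_def
    proof (rule Least_equality)
      fix k assume k: "2 \<le> k \<and> one_over_k k \<gamma>"
      then show "n \<le> k"
        using iff[of k] not_one_over_less_num_segments[OF n, of k] by (cases "k < n") auto
    qed (use calculation in blast)
    ultimately show ?thesis by blast
  qed
  obtain n where n: "composed_of_segments \<gamma> n" using composed_of_segments_exists by blast
  have uniq: "m = n" if "composed_of_segments \<gamma> m" for m using *[OF that] *[OF n] by simp
  then have "num_segments \<gamma> = n" unfolding num_segments_def using n by (intro the_equality)
  then show ?thesis using n uniq *[OF n] by blast
qed

end
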